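(* Let $E\neq\{0\}$ be a real Banach space, let $M\subset E$ be a subset, and let $M_L\subset M$. The following two assertions are equivalent: (i) $M$ is epi-Lipschitzian at every point of $M_L$; (ii) there are an open subset $U$ of $E$ containing $M_L$ and a locally Lipschitz function $f:U\to\mathbb{R}$ such that $$M\cap U=\{x\in U\mid f(x)\le 0\}$$ and $$0\notin\partial f(x)\quad\text{for every } x\in \operatorname{bd} M\cap U.$$
   Context: $\operatorname{bd} M$ denotes the topological boundary of $M$ in $E$. Epi-Lipschitzian sets: a subset $M$ of a Banach space $E$ is epi-Lipschitzian at $x\in M$ if there exist a neighborhood $W$ of $x$, a Banach space $F$ (possibly $\{0\}$), a Banach isomorphism (bijective linear map, continuous with continuous inverse) $A:E\to F\times\mathbb{R}$, and a map $\Phi:F\to\mathbb{R}$ which is Lipschitz on some neighborhood of the $F$-component of $A(x)$, such that $M\cap W=W\cap A^{-1}(\operatorname{epi}\Phi)$, where $\operatorname{epi}\Phi=\{(\xi,t)\in F\times\mathbb{R}\mid \Phi(\xi)\le t\}$. Clarke's generalized gradient: for a locally Lipschitz function $f:U\to\mathbb{R}$ on an open set $U\subset E$, $x\in U$, $v\in E$, the generalized directional derivative is $$f^0(x,v)=\limsup_{y\to x,\ t>0,\ t\to 0}\frac{f(y+tv)-f(y)}{t},$$ and the generalized gradient of $f$ at $x$ is $\partial f(x)=\{\xi\in E^*\mid \forall v\in E,\ f^0(x,v)\ge\langle\xi,v\rangle\}$, where $E^*$ is the topological dual of $E$. *)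

theory Defs
  imports "HOL-Analysis.Analysis"
begin

section \<open>Banach spaces on a carrier\<close>

text \<open>
  The model space \<open>F\<close> of an epi-Lipschitzian chart is existentially quantified, and types cannot
  be. Normed spaces are therefore given here as a carrier set together with operations that are
  relevant on the carrier only.
\<close>

record 'f nspace =
  ns_carrier :: "'f set"
  ns_zero :: 'f
  ns_add :: "'f \<Rightarrow> 'f \<Rightarrow> 'f"
  ns_scale :: "real \<Rightarrow> 'f \<Rightarrow> 'f"
  ns_norm :: "'f \<Rightarrow> real"

text \<open>
  The value \<open>0\<close> off the carrier is needed because \<^locale>\<open>Metric_space\<close> requires
  nonnegativity and symmetry of the distance on the whole type.
\<close>

definition ns_dist :: "'f nspace \<Rightarrow> 'f \<Rightarrow> 'f \<Rightarrow> real" where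
  "ns_dist F u v =
     (if u \<in> ns_carrier F \<and> v \<in> ns_carrier F
      then ns_norm F (ns_add F u (ns_scale F (- 1) v)) else 0)"

locale normed_nspace =
  fixes F :: "'f nspace"
  assumes zero_closed: "ns_zero F \<in> ns_carrier F"
    and add_closed: "\<lbrakk>u \<in> ns_carrier F; v \<in> ns_carrier F\<rbrakk> \<Longrightarrow> ns_add F u v \<in> ns_carrier F"
    and scale_closed: "u \<in> ns_carrier F \<Longrightarrow> ns_scale F a u \<in> ns_carrier F"
    and add_assoc: "\<lbrakk>u \<in> ns_carrier F; v \<in> ns_carrier F; w \<in> ns_carrier F\<rbrakk>
      \<Longrightarrow> ns_add F (ns_add F u v) w = ns_add F u (ns_add F v w)"
    and add_comm: "\<lbrakk>u \<in> ns_carrier F; v \<in> ns_carrier F\<rbrakk> \<Longrightarrow> ns_add F u v = ns_add F v u"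
    and add_zero: "u \<in> ns_carrier F \<Longrightarrow> ns_add F u (ns_zero F) = u"
    and add_inverse: "u \<in> ns_carrier F \<Longrightarrow> \<exists>v\<in>ns_carrier F. ns_add F u v = ns_zero F"
    and scale_add_right: "\<lbrakk>u \<in> ns_carrier F; v \<in> ns_carrier F\<rbrakk>
      \<Longrightarrow> ns_scale F a (ns_add F u v) = ns_add F (ns_scale F a u) (ns_scale F a v)"
    and scale_add_left: "u \<in> ns_carrier F
      \<Longrightarrow> ns_scale F (a + b) u = ns_add F (ns_scale F a u) (ns_scale F b u)"
    and scale_scale: "u \<in> ns_carrier F \<Longrightarrow> ns_scale F a (ns_scale F b u) = ns_scale F (a * b) u"
    and scale_one: "u \<in> ns_carrier F \<Longrightarrow> ns_scale F 1 u = u"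
    and norm_eq_zero: "u \<in> ns_carrier F \<Longrightarrow> ns_norm F u = 0 \<longleftrightarrow> u = ns_zero F"
    and norm_triangle: "\<lbrakk>u \<in> ns_carrier F; v \<in> ns_carrier F\<rbrakk>
      \<Longrightarrow> ns_norm F (ns_add F u v) \<le> ns_norm F u + ns_norm F v"
    and norm_scale: "u \<in> ns_carrier F \<Longrightarrow> ns_norm F (ns_scale F a u) = \<bar>a\<bar> * ns_norm F u"
begin

lemma scale_zero_left: "u \<in> ns_carrier F \<Longrightarrow> ns_scale F 0 u = ns_zero F"
  by (metis abs_zero mult_zero_left norm_eq_zero norm_scale scale_closed)

lemma add_minus: "u \<in> ns_carrier F \<Longrightarrow> ns_add F u (ns_scale F (- 1) u) = ns_zero F"
  using scale_add_left[of u 1 "- 1"] by (simp add: scale_one scale_zero_left)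

lemma minus_minus: "u \<in> ns_carrier F \<Longrightarrow> ns_scale F (- 1) (ns_scale F (- 1) u) = u"
  by (simp add: scale_scale scale_one)

lemma norm_nonneg: "u \<in> ns_carrier F \<Longrightarrow> 0 \<le> ns_norm F u"
  using norm_triangle[of u "ns_scale F (- 1) u"] norm_eq_zero[of "ns_zero F"]
  by (simp add: scale_closed add_minus zero_closed norm_scale)

lemma diff_telescope:
  assumes "u \<in> ns_carrier F" "v \<in> ns_carrier F" "w \<in> ns_carrier F"
  shows "ns_add F u (ns_scale F (- 1) w) =
    ns_add F (ns_add F u (ns_scale F (- 1) v)) (ns_add F v (ns_scale F (- 1) w))"
proof -
  let ?m = "ns_scale F (- 1)"
  have "ns_add F (ns_add F u (?m v)) (ns_add F v (?m w))
      = ns_add F u (ns_add F (ns_add F (?m v) v) (?m w))"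
    using assms by (simp add: add_assoc add_closed scale_closed)
  also have "ns_add F (?m v) v = ns_zero F"
    using assms by (simp add: add_comm add_minus scale_closed)
  also have "ns_add F (ns_zero F) (?m w) = ?m w"
    using assms by (metis add_comm add_zero scale_closed zero_closed)
  finally show ?thesis by simp
qed

lemma ns_dist_commute: "ns_dist F u v = ns_dist F v u"
proof (cases "u \<in> ns_carrier F \<and> v \<in> ns_carrier F")
  case True
  then have "ns_add F v (ns_scale F (- 1) u)
      = ns_scale F (- 1) (ns_add F u (ns_scale F (- 1) v))"
    by (simp add: scale_add_right scale_closed minus_minus add_comm)
  then show ?thesis
    using True by (simp add: ns_dist_def norm_scale add_closed scale_closed)
qed (auto simp: ns_dist_def)

lemma ns_dist_eq_zero:
  assumes "u \<in> ns_carrier F" "v \<in> ns_carrier F"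
  shows "ns_dist F u v = 0 \<longleftrightarrow> u = v"
proof
  let ?m = "ns_scale F (- 1)"
  assume "ns_dist F u v = 0"
  then have 0: "ns_add F u (?m v) = ns_zero F"
    using assms by (simp add: ns_dist_def norm_eq_zero add_closed scale_closed)
  have "u = ns_add F u (ns_add F (?m v) v)"
    using assms by (simp add: add_comm add_minus add_zero scale_closed)
  also have "\<dots> = ns_add F (ns_zero F) v"
    using assms 0 by (simp add: add_assoc[symmetric] scale_closed)
  finally show "u = v"
    using assms by (metis add_comm add_zero zero_closed)
qed (use assms in \<open>simp add: ns_dist_def add_minus norm_eq_zero zero_closed\<close>)

sublocale metric: Metric_space "ns_carrier F" "ns_dist F"
proof
  show "0 \<le> ns_dist F u v" for u v
    by (simp add: ns_dist_def norm_nonneg add_closed scale_closed)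
  show "ns_dist F u v = ns_dist F v u" for u v
    by (rule ns_dist_commute)
  show "\<lbrakk>u \<in> ns_carrier F; v \<in> ns_carrier F\<rbrakk> \<Longrightarrow> ns_dist F u v = 0 \<longleftrightarrow> u = v" for u v
    by (rule ns_dist_eq_zero)
  show "ns_dist F u w \<le> ns_dist F u v + ns_dist F v w"
    if "u \<in> ns_carrier F" "v \<in> ns_carrier F" "w \<in> ns_carrier F" for u v w
    using that by (simp add: ns_dist_def diff_telescope[of u v w] norm_triangle add_closed scale_closed)
qed

end

abbreviation ns_topology :: "'f nspace \<Rightarrow> 'f topology" where
  "ns_topology F \<equiv> Metric_space.mtopology (ns_carrier F) (ns_dist F)"

locale banach_nspace = normed_nspace +
  assumes complete: "Metric_space.mcomplete (ns_carrier F) (ns_dist F)"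


section \<open>Epi-Lipschitzian sets\<close>

definition ns_epi :: "'f nspace \<Rightarrow> ('f \<Rightarrow> real) \<Rightarrow> ('f \<times> real) set" where
  "ns_epi F \<Phi> = {(\<xi>, t). \<xi> \<in> ns_carrier F \<and> \<Phi> \<xi> \<le> t}"

text \<open>Banach isomorphisms from the type \<open>'a\<close> onto the product of \<open>F\<close> and the real line\<close>

definition banach_iso_times_real ::
    "'f nspace \<Rightarrow> ('a::real_normed_vector \<Rightarrow> 'f \<times> real) \<Rightarrow> bool" where
  "banach_iso_times_real F A \<longleftrightarrow>
     (\<forall>x y. A (x + y) = (ns_add F (fst (A x)) (fst (A y)), snd (A x) + snd (A y))) \<and>
     (\<forall>c x. A (c *\<^sub>R x) = (ns_scale F c (fst (A x)), c * snd (A x))) \<and>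
     homeomorphic_map euclidean (prod_topology (ns_topology F) euclideanreal) A"

definition ns_lipschitz_near :: "'f nspace \<Rightarrow> 'f \<Rightarrow> ('f \<Rightarrow> real) \<Rightarrow> bool" where
  "ns_lipschitz_near F \<xi> \<Phi> \<longleftrightarrow>
     (\<exists>V L. openin (ns_topology F) V \<and> \<xi> \<in> V \<and>
        (\<forall>u\<in>V. \<forall>v\<in>V. \<bar>\<Phi> u - \<Phi> v\<bar> \<le> L * ns_dist F u v))"

definition epi_lipschitzian_in ::
    "'f nspace \<Rightarrow> 'a::real_normed_vector set \<Rightarrow> 'a \<Rightarrow> bool" where
  "epi_lipschitzian_in F M x \<longleftrightarrow>
     banach_nspace F \<and>
     (\<exists>W A \<Phi>. x \<in> interior W \<and> banach_iso_times_real F A \<and>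
        ns_lipschitz_near F (fst (A x)) \<Phi> \<and>
        M \<inter> W = W \<inter> A -` ns_epi F \<Phi>)"

text \<open>
  The carrier of \<open>F\<close> ranges over sets of elements of \<open>'a\<close>. This loses no generality: an \<open>F\<close> as
  required embeds linearly into the ambient space, see \<open>epi_lipschitzian_atI\<close> and
  \<open>epi_lipschitzian_atI_type\<close> below.
\<close>

definition epi_lipschitzian_at :: "'a::banach set \<Rightarrow> 'a \<Rightarrow> bool" where
  "epi_lipschitzian_at M x \<longleftrightarrow> x \<in> M \<and> (\<exists>F :: 'a nspace. epi_lipschitzian_in F M x)"


subsection \<open>Independence of the type of the carrier\<close>

definition ns_transport :: "('f \<Rightarrow> 'g) \<Rightarrow> 'f nspace \<Rightarrow> 'g nspace" where
  "ns_transport j F = (let h = inv_into (ns_carrier F) j in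
     \<lparr>ns_carrier = j ` ns_carrier F, ns_zero = j (ns_zero F),
      ns_add = (\<lambda>u v. j (ns_add F (h u) (h v))), ns_scale = (\<lambda>a u. j (ns_scale F a (h u))),
      ns_norm = (\<lambda>u. ns_norm F (h u))\<rparr>)"

locale ns_transporting = banach_nspace F for F :: "'f nspace" +
  fixes j :: "'f \<Rightarrow> 'g"
  assumes inj: "inj_on j (ns_carrier F)"
begin

abbreviation "G \<equiv> ns_transport j F"

lemma G_simps [simp]:
  "ns_carrier G = j ` ns_carrier F"
  "ns_zero G = j (ns_zero F)"
  "\<lbrakk>u \<in> ns_carrier F; v \<in> ns_carrier F\<rbrakk> \<Longrightarrow> ns_add G (j u) (j v) = j (ns_add F u v)"
  "u \<in> ns_carrier F \<Longrightarrow> ns_scale G a (j u) = j (ns_scale F a u)"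
  "u \<in> ns_carrier F \<Longrightarrow> ns_norm G (j u) = ns_norm F u"
  using inj by (simp_all add: ns_transport_def Let_def)

lemma G_dist: "\<lbrakk>u \<in> ns_carrier F; v \<in> ns_carrier F\<rbrakk> \<Longrightarrow> ns_dist G (j u) (j v) = ns_dist F u v"
  by (simp add: ns_dist_def add_closed scale_closed)

lemma G_normed: "normed_nspace G"
proof
  show "u \<in> ns_carrier G \<Longrightarrow> ns_norm G u = 0 \<longleftrightarrow> u = ns_zero G" for u
    using inj by (auto simp: norm_eq_zero zero_closed inj_on_eq_iff)
  show "u \<in> ns_carrier G \<Longrightarrow> \<exists>v\<in>ns_carrier G. ns_add G u v = ns_zero G" for u
  proof -
    assume "u \<in> ns_carrier G"
    then obtain w where w: "w \<in> ns_carrier F" "u = j w"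
      by auto
    obtain v where "v \<in> ns_carrier F" "ns_add F w v = ns_zero F"
      using add_inverse w by blast
    then show ?thesis
      using w by (intro bexI[of _ "j v"]) auto
  qed
  show "\<lbrakk>u \<in> ns_carrier G; v \<in> ns_carrier G\<rbrakk> \<Longrightarrow> ns_add G u v = ns_add G v u" for u v
    using add_comm by fastforce
qed (auto simp: zero_closed add_closed scale_closed add_assoc add_zero
       scale_add_right scale_add_left scale_scale scale_one norm_triangle norm_scale)

interpretation G: normed_nspace G
  by (rule G_normed)

interpretation FG: Metric_space12 "ns_carrier F" "ns_dist F" "ns_carrier G" "ns_dist G"
  by unfold_locales

lemma homeo: "homeomorphic_map (ns_topology F) (ns_topology G) j"
  by (rule FG.isometry_imp_homeomorphic_map) (auto simp: G_dist)

lemma G_banach: "banach_nspace G"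
proof
  show "Metric_space.mcomplete (ns_carrier G) (ns_dist G)"
    unfolding G.metric.mcomplete_def
  proof (intro allI impI)
    fix \<sigma> assume \<sigma>: "G.metric.MCauchy \<sigma>"
    define \<tau> where "\<tau> = inv_into (ns_carrier F) j \<circ> \<sigma>"
    have \<tau>: "\<tau> n \<in> ns_carrier F" "j (\<tau> n) = \<sigma> n" for n
    proof -
      have "\<sigma> n \<in> j ` ns_carrier F"
        using \<sigma> unfolding G.metric.MCauchy_def by auto
      then show "\<tau> n \<in> ns_carrier F" "j (\<tau> n) = \<sigma> n"
        by (auto simp: \<tau>_def inv_into_into f_inv_into_f)
    qed
    have "ns_dist F (\<tau> m) (\<tau> n) = ns_dist G (\<sigma> m) (\<sigma> n)" for m n
      using G_dist[of "\<tau> m" "\<tau> n"] \<tau> by simp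
    then have "metric.MCauchy \<tau>"
      using \<sigma> \<tau>(1) unfolding metric.MCauchy_def G.metric.MCauchy_def by auto
    then obtain l where "limitin (ns_topology F) \<tau> l sequentially"
      using complete by (auto simp: metric.mcomplete_def)
    then have "limitin (ns_topology G) (j \<circ> \<tau>) (j l) sequentially"
      using homeo by (meson continuous_map_limit homeomorphic_imp_continuous_map)
    moreover have "j \<circ> \<tau> = \<sigma>"
      using \<tau> by auto
    ultimately show "\<exists>l. limitin (ns_topology G) \<sigma> l sequentially"
      by auto
  qed
qed

lemma epi_lipschitzian_in_transport:
  assumes "epi_lipschitzian_in F M x"
  shows "epi_lipschitzian_in G M x"
proof -
  obtain W A \<Phi> where x: "x \<in> interior W" and A: "banach_iso_times_real F A"
    and \<Phi>: "ns_lipschitz_near F (fst (A x)) \<Phi>" and M: "M \<inter> W = W \<inter> A -` ns_epi F \<Phi>"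
    using assms unfolding epi_lipschitzian_in_def by blast
  define B where "B = map_prod j id \<circ> A"
  define \<Psi> where "\<Psi> = \<Phi> \<circ> inv_into (ns_carrier F) j"
  have \<Psi>: "\<Psi> (j u) = \<Phi> u" if "u \<in> ns_carrier F" for u
    using that inj by (simp add: \<Psi>_def)
  have homA: "homeomorphic_map euclidean (prod_topology (ns_topology F) euclideanreal) A"
    using A by (simp add: banach_iso_times_real_def)
  have Acar: "fst (A y) \<in> ns_carrier F" for y
  proof -
    have "A y \<in> topspace (prod_topology (ns_topology F) euclideanreal)"
      using homeomorphic_imp_surjective_map[OF homA] by (metis rangeI topspace_euclidean)
    then show ?thesis
      by (auto simp: mem_Times_iff)
  qed
  obtain k where "homeomorphic_maps (ns_topology F) (ns_topology G) j k"
    using homeo homeomorphic_map_maps by blast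
  moreover have "homeomorphic_maps euclideanreal euclideanreal id id"
    by (simp add: homeomorphic_maps_def)
  ultimately have "homeomorphic_map (prod_topology (ns_topology F) euclideanreal)
      (prod_topology (ns_topology G) euclideanreal) (\<lambda>(u, t). (j u, id t))"
    unfolding homeomorphic_map_maps using homeomorphic_maps_prod by blast
  moreover have "(\<lambda>(u, t). (j u, id t)) = (map_prod j id :: 'f \<times> real \<Rightarrow> 'g \<times> real)"
    by (simp add: map_prod_def)
  ultimately have "homeomorphic_map euclidean (prod_topology (ns_topology G) euclideanreal) B"
    unfolding B_def using homA homeomorphic_map_compose by metis
  then have "banach_iso_times_real G B"
    using A Acar by (auto simp: banach_iso_times_real_def B_def)
  moreover have "ns_lipschitz_near G (fst (B x)) \<Psi>"
  proof -
    obtain V L where V: "openin (ns_topology F) V" "fst (A x) \<in> V"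
      and L: "\<forall>u\<in>V. \<forall>v\<in>V. \<bar>\<Phi> u - \<Phi> v\<bar> \<le> L * ns_dist F u v"
      using \<Phi> unfolding ns_lipschitz_near_def by blast
    have sub: "V \<subseteq> ns_carrier F"
      using openin_subset[OF V(1)] by simp
    then have "openin (ns_topology G) (j ` V)"
      using V(1) homeo homeomorphic_map_openness by (metis metric.topspace_mtopology)
    moreover have "\<forall>u\<in>j ` V. \<forall>v\<in>j ` V. \<bar>\<Psi> u - \<Psi> v\<bar> \<le> L * ns_dist G u v"
      using L sub by (auto simp: \<Psi> G_dist subset_iff)
    ultimately show ?thesis
      using V(2) unfolding ns_lipschitz_near_def B_def by (intro exI[of _ "j ` V"] exI[of _ L]) auto
  qed
  moreover have "B -` ns_epi G \<Psi> = A -` ns_epi F \<Phi>"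
    using Acar \<Psi> by (auto simp: B_def ns_epi_def map_prod_def split: prod.splits) (metis fst_conv)+
  ultimately show ?thesis
    unfolding epi_lipschitzian_in_def using x M G_banach by metis
qed

end

theorem epi_lipschitzian_atI:
  fixes F :: "'f nspace" and M :: "'a::banach set"
  assumes "x \<in> M" and "epi_lipschitzian_in F M x"
  shows "epi_lipschitzian_at M x"
proof -
  obtain A :: "'a \<Rightarrow> 'f \<times> real" where A: "banach_iso_times_real F A" and F: "banach_nspace F"
    using assms(2) unfolding epi_lipschitzian_in_def by blast
  interpret banach_nspace F by (rule F)
  have "A ` UNIV = ns_carrier F \<times> UNIV"
    using homeomorphic_imp_surjective_map[of euclidean "prod_topology (ns_topology F) euclideanreal" A] A
    by (simp add: banach_iso_times_real_def)
  then have "inj_on (\<lambda>u. inv A (u, 0)) (ns_carrier F)"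
    by (intro inj_onI) (metis (no_types, lifting) SigmaI UNIV_I f_inv_into_f fst_conv)
  then interpret ns_transporting F "\<lambda>u. inv A (u, 0)"
    by unfold_locales
  show ?thesis
    using epi_lipschitzian_in_transport[OF assms(2)] assms(1)
    unfolding epi_lipschitzian_at_def by blast
qed

definition ns_of_type :: "'f::real_normed_vector nspace" where
  "ns_of_type = \<lparr>ns_carrier = UNIV, ns_zero = 0, ns_add = (+), ns_scale = (*\<^sub>R), ns_norm = norm\<rparr>"

lemma ns_dist_of_type: "ns_dist (ns_of_type :: 'f::real_normed_vector nspace) = dist"
  by (intro ext) (simp add: ns_dist_def ns_of_type_def dist_norm)

lemma ns_carrier_of_type: "ns_carrier ns_of_type = UNIV"
  by (simp add: ns_of_type_def)

lemma banach_ns_of_type: "banach_nspace (ns_of_type :: 'f::banach nspace)"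
proof
  show "Metric_space.mcomplete (ns_carrier (ns_of_type :: 'f nspace)) (ns_dist ns_of_type)"
    using convergent_eq_Cauchy
    by (auto simp: ns_carrier_of_type ns_dist_of_type Met_TC.mcomplete_def)
  show "\<exists>v\<in>ns_carrier ns_of_type. ns_add ns_of_type u v = ns_zero ns_of_type" for u :: 'f
    by (auto simp: ns_of_type_def intro: exI[of _ "- u"])
qed (auto simp: ns_of_type_def algebra_simps norm_triangle_ineq)

theorem epi_lipschitzian_atI_type:
  fixes M :: "'a::banach set" and A :: "'a \<Rightarrow> 'f::banach \<times> real" and \<Phi> :: "'f \<Rightarrow> real"
  assumes "x \<in> M" and "x \<in> interior W"
    and "linear A" and "homeomorphism UNIV UNIV A B"
    and "open V" and "fst (A x) \<in> V" and "L-lipschitz_on V \<Phi>"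
    and "M \<inter> W = W \<inter> A -` {(\<xi>, t). \<Phi> \<xi> \<le> t}"
  shows "epi_lipschitzian_at M x"
proof (rule epi_lipschitzian_atI[OF assms(1), of "ns_of_type :: 'f nspace"])
  have top: "ns_topology (ns_of_type :: 'f nspace) = euclidean"
    by (simp add: ns_carrier_of_type ns_dist_of_type)
  have "homeomorphic_map euclidean euclidean A"
    using assms(4)
    by (auto simp: homeomorphic_map_maps homeomorphic_maps_def homeomorphism_def intro!: exI[of _ B])
  then have "homeomorphic_map euclidean (prod_topology (ns_topology ns_of_type) euclideanreal) A"
    by (simp add: top euclidean_product_topology)
  then have "banach_iso_times_real ns_of_type A"
    using assms(3) by (simp add: banach_iso_times_real_def ns_of_type_def linear_add linear_scale prod_eq_iff)
  moreover have "ns_lipschitz_near ns_of_type (fst (A x)) \<Phi>"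
    unfolding ns_lipschitz_near_def top unfolding ns_dist_of_type
  proof (intro exI conjI)
    show "openin euclidean V" "fst (A x) \<in> V"
      using assms(5,6) by simp_all
    show "\<forall>u\<in>V. \<forall>v\<in>V. \<bar>\<Phi> u - \<Phi> v\<bar> \<le> L * dist u v"
      using lipschitz_onD[OF assms(7)] by (simp add: dist_real_def)
  qed
  moreover have "ns_epi ns_of_type \<Phi> = {(\<xi>, t). \<Phi> \<xi> \<le> t}"
    by (simp add: ns_epi_def ns_carrier_of_type)
  ultimately show "epi_lipschitzian_in (ns_of_type :: 'f nspace) M x"
    unfolding epi_lipschitzian_in_def using banach_ns_of_type assms(2,8)
    by (intro conjI exI[of _ W] exI[of _ A] exI[of _ \<Phi>]) simp_all
qed


section \<open>Clarke's generalized gradient\<close>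

definition locally_lipschitz_on :: "'a::metric_space set \<Rightarrow> ('a \<Rightarrow> real) \<Rightarrow> bool" where
  "locally_lipschitz_on U f \<longleftrightarrow>
     (\<forall>x\<in>U. \<exists>V L. open V \<and> x \<in> V \<and> L-lipschitz_on (V \<inter> U) f)"

text \<open>
  Only the germ of \<open>f\<close> at \<open>x\<close> matters, so for \<open>x\<close> in an open set \<open>U\<close> the values of \<open>f\<close> outside
  \<open>U\<close> are irrelevant. The limit superior is taken in the extended reals.
\<close>

definition clarke_dir :: "('a::real_normed_vector \<Rightarrow> real) \<Rightarrow> 'a \<Rightarrow> 'a \<Rightarrow> ereal" where
  "clarke_dir f x v =
     Limsup (nhds x \<times>\<^sub>F at_right 0) (\<lambda>(y, t). ereal ((f (y + t *\<^sub>R v) - f y) / t))"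

definition clarke_gradient ::
    "('a::real_normed_vector \<Rightarrow> real) \<Rightarrow> 'a \<Rightarrow> ('a \<Rightarrow>\<^sub>L real) set" where
  "clarke_gradient f x = {\<xi>. \<forall>v. clarke_dir f x v \<ge> ereal (blinfun_apply \<xi> v)}"

end

theory Submission
  imports Defs
begin

text \<open>
  For the forward direction no gluing of the local graph functions is needed: near each point of
  \<open>M_L\<close> the set \<open>M\<close> contains a fixed truncated cone with vertex at any of its points, and in the
  direction of the axis of this cone the signed distance \<open>d(x, M) - d(x, - M)\<close> decreases at a rate
  at least the aperture.

  Conversely, if \<open>0 \<notin> \<partial>f(x)\<close>, then \<open>f\<close> strictly decreases at a uniform rate near \<open>x\<close> in some
  direction \<open>v\<close>. A Hahn-Banach functional \<open>\<phi>\<close> with \<open>\<phi> v = 1\<close> splits the space as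
  \<open>ker \<phi> \<times> \<real>\<close>, and along each line parallel to \<open>v\<close> the function \<open>f\<close> has a unique zero depending
  Lipschitz-continuously on the line.
\<close>


section \<open>Hahn--Banach\<close>

definition sublinear :: "('a::real_vector \<Rightarrow> real) \<Rightarrow> bool" where
  "sublinear p \<longleftrightarrow> (\<forall>x y. p (x + y) \<le> p x + p y) \<and> (\<forall>a x. a \<ge> 0 \<longrightarrow> p (a *\<^sub>R x) = a * p x)"

lemma sublinear_add: "sublinear p \<Longrightarrow> p (x + y) \<le> p x + p y"
  and sublinear_scale: "sublinear p \<Longrightarrow> a \<ge> 0 \<Longrightarrow> p (a *\<^sub>R x) = a * p x"
  by (simp_all add: sublinear_def)

lemma sublinear_zero: "sublinear p \<Longrightarrow> p 0 = 0"
  using sublinear_scale[of p 0 0] by simp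

lemma sublinear_ge_neg: "sublinear p \<Longrightarrow> - p (- x) \<le> p x"
  using sublinear_add[of p x "- x"] sublinear_zero[of p] by simp

lemma sublinear_decrease:
  assumes p: "sublinear p"
  shows "\<exists>q. sublinear q \<and> q \<le> p \<and> q (- y) \<le> - p y"
proof -
  text \<open>Minimality under this operation forces linearity; applied to a norm, it also keeps the
    linear functional below it from vanishing at \<open>y\<close>.\<close>
  define g where "g x t = p (x + t *\<^sub>R y) - t * p y" for x t
  define q where "q x = (INF t\<in>{0..}. g x t)" for x
  \<comment> \<open>This bound does not depend on \<open>t\<close>, so the infimum is finite;
    \<open>t *\<^sub>R y\<close> is split into \<open>x + t *\<^sub>R y\<close> and
    \<open>- x\<close>.\<close>
  have lower: "- p (- x) \<le> g x t" if "t \<ge> 0" for x t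
    using sublinear_add[OF p, of "x + t *\<^sub>R y" "- x"] sublinear_scale[OF p that, of y]
    by (simp add: g_def)
  then have bdd: "bdd_below (g x ` {0..})" for x
    by (meson atLeast_iff bdd_belowI2)
  have q_le: "q x \<le> g x t" if "t \<ge> 0" for x t
    unfolding q_def using that by (intro cINF_lower bdd) auto
  have q_ge: "c \<le> q x" if "\<And>t. t \<ge> 0 \<Longrightarrow> c \<le> g x t" for c x
    unfolding q_def using that by (intro cINF_greatest) auto
  have "q (x + x') \<le> q x + q x'" for x x'
  proof -
    have *: "q (x + x') \<le> g x s + g x' t" if "s \<ge> 0" "t \<ge> 0" for s t
      using q_le[of "s + t" "x + x'"] that sublinear_add[OF p, of "x + s *\<^sub>R y" "x' + t *\<^sub>R y"]
      by (simp add: g_def algebra_simps)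
    have "q (x + x') - g x s \<le> q x'" if "s \<ge> 0" for s
      using *[OF that] by (intro q_ge) (simp add: algebra_simps)
    then have "q (x + x') - q x' \<le> q x"
      by (intro q_ge) (simp add: algebra_simps)
    then show ?thesis by simp
  qed
  moreover have "q (a *\<^sub>R x) = a * q x" if "a \<ge> 0" for a x
  proof (cases "a = 0")
    case True
    have "q 0 = 0"
      using q_le[of 0 0] q_ge[of 0 0] lower[of _ 0] sublinear_zero[OF p]
      by (intro antisym) (auto simp: g_def)
    then show ?thesis using True by simp
  next
    case False
    with that have a: "a > 0" by simp
    have g: "g (a *\<^sub>R x) (a * t) = a * g x t" for t
      using sublinear_scale[OF p that, of "x + t *\<^sub>R y"] by (simp add: g_def algebra_simps)
    have "q (a *\<^sub>R x) / a \<le> q x"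
    proof (rule q_ge)
      fix t :: real assume "t \<ge> 0"
      then show "q (a *\<^sub>R x) / a \<le> g x t"
        using q_le[of "a * t" "a *\<^sub>R x"] g[of t] a by (simp add: field_simps)
    qed
    moreover have "a * q x \<le> q (a *\<^sub>R x)"
    proof (rule q_ge)
      fix t :: real assume "t \<ge> 0"
      then show "a * q x \<le> g (a *\<^sub>R x) t"
        using q_le[of "t / a" x] g[of "t / a"] a by (simp add: field_simps)
    qed
    ultimately show ?thesis
      using a by (simp add: field_simps)
  qed
  moreover have "q \<le> p"
    using q_le[of 0] by (simp add: g_def le_fun_def)
  moreover have "q (- y) \<le> - p y"
    using q_le[of 1 "- y"] sublinear_zero[OF p] by (simp add: g_def)
  ultimately show ?thesis
    unfolding sublinear_def by blast
qed

text \<open>Sublinear functions below \<open>p\<close> satisfy \<open>- p (- x) \<le> q x\<close>,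
  so the pointwise infimum is finite. It stays subadditive because the smaller of two chain members
  can be used at both points. This is the chain bound for Zorn's lemma.\<close>

lemma sublinear_Inf_chain:
  assumes C: "C \<noteq> {}" and sub: "\<And>q. q \<in> C \<Longrightarrow> sublinear q"
    and chain: "\<And>q r. q \<in> C \<Longrightarrow> r \<in> C \<Longrightarrow> q \<le> r \<or> r \<le> q"
    and le: "\<And>q. q \<in> C \<Longrightarrow> q \<le> p"
  shows "\<exists>u. sublinear u \<and> (\<forall>q\<in>C. u \<le> q)"
proof -
  define u where "u x = (INF q\<in>C. q x)" for x
  have "- p (- x) \<le> q x" if "q \<in> C" for q x
    using sublinear_ge_neg[OF sub[OF that], of x] le[OF that] by (smt (verit) le_funD)
  then have bdd: "bdd_below ((\<lambda>q. q x) ` C)" for x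
    by (meson bdd_belowI2)
  have u_le: "u x \<le> q x" if "q \<in> C" for x q
    unfolding u_def using that by (intro cINF_lower bdd) auto
  have u_ge: "c \<le> u x" if "\<And>q. q \<in> C \<Longrightarrow> c \<le> q x" for c x
    unfolding u_def using that C by (intro cINF_greatest) auto
  have "u (x + y) \<le> u x + u y" for x y
  proof -
    have *: "u (x + y) \<le> q x + r y" if "q \<in> C" "r \<in> C" for q r
      using chain[OF that] u_le[of _ "x + y"] sublinear_add[OF sub, of _ x y] that
      by (smt (verit) le_funD)
    have "u (x + y) - q x \<le> u y" if "q \<in> C" for q
      using *[OF that] by (intro u_ge) (simp add: algebra_simps)
    then have "u (x + y) - u y \<le> u x"
      by (intro u_ge) (simp add: algebra_simps)
    then show ?thesis by simp
  qed
  moreover have "u (a *\<^sub>R x) = a * u x" if "a \<ge> 0" for a x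
  proof (cases "a = 0")
    case True
    obtain q where "q \<in> C" using C by blast
    then have "u 0 = 0"
      using u_le[of q 0] u_ge[of 0 0] sub sublinear_zero by (metis order_antisym order_refl)
    then show ?thesis using True by simp
  next
    case False
    with that have a: "a > 0" by simp
    have s: "q (a *\<^sub>R x) = a * q x" if "q \<in> C" for q
      using sublinear_scale[OF sub[OF that]] a by simp
    have "u (a *\<^sub>R x) / a \<le> u x"
      using u_le[of _ "a *\<^sub>R x"] a s by (intro u_ge) (force simp: field_simps)
    moreover have "a * u x \<le> u (a *\<^sub>R x)"
    proof (rule u_ge)
      fix q assume "q \<in> C"
      then show "a * u x \<le> q (a *\<^sub>R x)"
        using u_le[of q x] s[of q] a by simp
    qed
    ultimately show ?thesis
      using a by (simp add: field_simps)
  qed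
  ultimately show ?thesis
    using u_le unfolding sublinear_def le_fun_def by blast
qed

text \<open>A minimal sublinear \<open>m\<close> below \<open>p\<close> cannot be lowered by
  \<open>sublinear_decrease\<close>, so \<open>m (- y) \<le> - m y\<close> for every
  \<open>y\<close>. Hence \<open>m\<close> is odd, and an odd sublinear function is linear.\<close>

lemma hahn_banach_sublinear:
  assumes p: "sublinear p"
  shows "\<exists>\<phi>. linear \<phi> \<and> \<phi> \<le> p"
proof -
  define A where "A = {q. sublinear q \<and> q \<le> p}"
  let ?R = "relation_of (\<lambda>q r. r \<le> q) A"
  \<comment> \<open>Zorn's lemma yields maximal elements, so the order is reversed in
    \<open>?R\<close>.\<close>
  have "\<exists>m\<in>A. \<forall>q\<in>A. q \<le> m \<longrightarrow> q = m"
  proof (rule predicate_Zorn)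
    show "partial_order_on A ?R"
      by (auto simp: partial_order_on_def preorder_on_def refl_on_def trans_def antisym_def
          relation_of_def)
  next
    fix C assume C: "C \<in> Chains ?R"
    show "\<exists>u\<in>A. \<forall>q\<in>C. u \<le> q"
    proof (cases "C = {}")
      case True
      then show ?thesis using p by (auto simp: A_def)
    next
      case False
      have CA: "C \<subseteq> A" and chain: "q \<le> r \<or> r \<le> q" if "q \<in> C" "r \<in> C" for q r
        using C that by (auto simp: Chains_def relation_of_def)
      obtain u where "sublinear u" and u: "\<forall>q\<in>C. u \<le> q"
        using sublinear_Inf_chain[OF False, of p] CA chain unfolding A_def by blast
      moreover have "u \<le> p"
        using u CA False unfolding A_def by (blast intro: order_trans)
      ultimately show ?thesis
        by (auto simp: A_def)
    qed
  qed
  then obtain m where m: "sublinear m" "m \<le> p"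
    and min: "\<And>q. sublinear q \<Longrightarrow> q \<le> m \<Longrightarrow> q = m"
    unfolding A_def by (auto intro: order_trans)
  have neg: "m (- y) = - m y" for y
    using sublinear_decrease[OF m(1), of y] min sublinear_ge_neg[OF m(1), of y] by force
  have "m (x + y) = m x + m y" for x y
    using sublinear_add[OF m(1), of x y] sublinear_add[OF m(1), of "x + y" "- y"] neg[of y] by simp
  moreover have "m (a *\<^sub>R x) = a *\<^sub>R m x" for a x
  proof (cases "a \<ge> 0")
    case True
    then show ?thesis using sublinear_scale[OF m(1)] by simp
  next
    case False
    then show ?thesis
      using sublinear_scale[OF m(1), of "- a" x] neg[of "a *\<^sub>R x"] by simp
  qed
  ultimately show ?thesis
    using m(2) by (blast intro: linearI)
qed

text \<open>The norm is first lowered to a sublinear \<open>q\<close> with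
  \<open>q (- v) \<le> - norm v\<close>. A linear functional below \<open>q\<close> is bounded by
  the norm and is at least \<open>norm v\<close> at \<open>v\<close>, so it can be
  normalized.\<close>

lemma exists_bounded_linear_eq_one:
  fixes v :: "'a::real_normed_vector"
  assumes "v \<noteq> 0"
  shows "\<exists>\<phi> :: 'a \<Rightarrow> real. bounded_linear \<phi> \<and> \<phi> v = 1"
proof -
  have "sublinear (norm :: 'a \<Rightarrow> real)"
    by (simp add: sublinear_def norm_triangle_ineq)
  then obtain q where q: "sublinear q" "q \<le> norm" "q (- v) \<le> - norm v"
    using sublinear_decrease by blast
  obtain \<phi> where \<phi>: "linear \<phi>" "\<phi> \<le> q"
    using hahn_banach_sublinear[OF q(1)] by blast
  have le: "\<phi> x \<le> norm x" for x
    using \<phi>(2) q(2) by (meson le_funD order_trans)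
  have "norm (\<phi> x) \<le> norm x * 1" for x
    using le[of x] le[of "- x"] by (simp add: linear_neg[OF \<phi>(1)])
  then have bl: "bounded_linear \<phi>"
    using \<phi>(1) by (intro bounded_linear_intro[of _ 1]) (auto simp: linear_add linear_scale)
  have "\<phi> (- v) \<le> - norm v"
    using \<phi>(2) q(3) by (meson le_funD order_trans)
  then have "\<phi> v \<noteq> 0"
    using assms by (auto simp: linear_neg[OF \<phi>(1)])
  moreover have "bounded_linear (\<lambda>x. \<phi> x / \<phi> v)"
    using bl by (rule bounded_linear_divide[THEN bounded_linear_compose])
  ultimately show ?thesis
    by (intro exI[of _ "\<lambda>x. \<phi> x / \<phi> v"]) simp
qed


section \<open>Uniform cones and the signed distance\<close>

text \<open>For \<open>e > 0\<close> and \<open>x\<close> in \<open>M\<close> this says that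
  \<open>v\<close> is hypertangent to \<open>M\<close> at \<open>x\<close> in Clarke's sense. One
  number \<open>e\<close> controls base points, step lengths and aperture.\<close>

definition uniform_cone :: "'a::real_normed_vector set \<Rightarrow> 'a \<Rightarrow> real \<Rightarrow> 'a \<Rightarrow> bool" where
  "uniform_cone M v e x \<longleftrightarrow>
     (\<forall>w\<in>M \<inter> ball x e. \<forall>t v'. 0 < t \<longrightarrow> t < e \<longrightarrow> dist v' v < e \<longrightarrow> w + t *\<^sub>R v' \<in> M)"

lemma uniform_coneD:
  "\<lbrakk>uniform_cone M v e x; w \<in> M; dist x w < e; 0 < t; t < e; dist v' v < e\<rbrakk> \<Longrightarrow> w + t *\<^sub>R v' \<in> M"
  by (simp add: uniform_cone_def)

lemma dist_less_scaleRI: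
  fixes u v :: "'a::real_normed_vector"
  assumes "t > 0" "t *\<^sub>R (u - v) = d" "norm d < t * e"
  shows "dist u v < e"
proof -
  have "t * dist u v = norm d"
    using assms(1) by (simp add: dist_norm flip: assms(2))
  then show ?thesis
    using assms by (metis mult_less_cancel_left_pos)
qed

text \<open>Recentres the cone at a frontier point that need not lie in \<open>M_L\<close>; the
  triangle inequality costs \<open>dist x y\<close> of the radius.\<close>

lemma uniform_cone_shift:
  assumes "uniform_cone M v e x" "dist x y < e"
  shows "uniform_cone M v (e - dist x y) y"
  unfolding uniform_cone_def
proof (intro ballI allI impI)
  fix w t v'
  assume *: "w \<in> M \<inter> ball y (e - dist x y)" "0 < t" "t < e - dist x y" "dist v' v < e - dist x y"
  then have "dist x w < e"
    using dist_triangle[of x w y] by simp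
  moreover have "t < e" "dist v' v < e"
    using *(3,4) zero_le_dist[of x y] by linarith+
  ultimately show "w + t *\<^sub>R v' \<in> M"
    using *(1,2) uniform_coneD[OF assms(1)] by blast
qed

text \<open>The aperture is spent on approximating \<open>y\<close> from \<open>M\<close>, which
  leaves only the axis \<open>v\<close> for points of the closure.\<close>

lemma uniform_cone_closure:
  assumes "uniform_cone M v e x" "dist x y < e" "y \<in> closure M" "0 < t" "t < e"
  shows "y + t *\<^sub>R v \<in> M"
proof -
  define d where "d = min (e - dist x y) (t * e)"
  have "d > 0"
    using assms by (simp add: d_def)
  then obtain w where w: "w \<in> M" "dist w y < d"
    using assms(3) closure_approachable by blast
  text \<open>The direction is tilted so that the segment starting at \<open>w\<close> ends at \<open>y + t *\<^sub>R v\<close>.\<close>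
  let ?v = "v + (y - w) /\<^sub>R t"
  have "dist x w < e"
    using w(2) dist_triangle[of x w y] by (simp add: d_def dist_commute)
  moreover have "dist ?v v < e"
    using w(2) assms(4)
    by (intro dist_less_scaleRI[of t _ _ "y - w"]) (auto simp: d_def dist_norm norm_minus_commute)
  ultimately have "w + t *\<^sub>R ?v \<in> M"
    using w(1) assms by (intro uniform_coneD[OF assms(1)]) auto
  then show ?thesis
    using assms(4) by (simp add: algebra_simps)
qed

text \<open>\<open>v\<close> is the preimage of the vertical vector \<open>(0, 1)\<close>. In
  directions near \<open>v\<close> the height grows faster than the Lipschitz function
  \<open>\<Phi>\<close> can, which gives the cone. The second conclusion results from letting
  \<open>t\<close> tend to 0 in \<open>\<Phi> \<xi> \<le> s + t\<close>; together with
  \<open>uniform_cone_closure\<close> it makes \<open>M\<close> relatively closed near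
  \<open>x\<close>.\<close>

lemma epi_lipschitzian_uniform_cone:
  assumes "epi_lipschitzian_at M x"
  shows "\<exists>v e. e > 0 \<and> uniform_cone M v e x \<and>
    (\<forall>y. dist x y < e \<longrightarrow> (\<forall>t. 0 < t \<longrightarrow> t < e \<longrightarrow> y + t *\<^sub>R v \<in> M) \<longrightarrow> y \<in> M)"
proof -
  obtain F :: "'a nspace" and W A \<Phi> where F: "banach_nspace F" and xW: "x \<in> interior W"
    and A: "banach_iso_times_real F A" and \<Phi>: "ns_lipschitz_near F (fst (A x)) \<Phi>"
    and MW: "M \<inter> W = W \<inter> A -` ns_epi F \<Phi>"
    using assms unfolding epi_lipschitzian_at_def epi_lipschitzian_in_def by blast
  interpret banach_nspace F by (rule F)
  obtain V L where V: "openin (ns_topology F) V" "fst (A x) \<in> V"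
    and L: "\<And>u u'. u \<in> V \<Longrightarrow> u' \<in> V \<Longrightarrow> \<bar>\<Phi> u - \<Phi> u'\<bar> \<le> L * ns_dist F u u'"
    using \<Phi> unfolding ns_lipschitz_near_def by blast
  have A_add: "A (y + z) = (ns_add F (fst (A y)) (fst (A z)), snd (A y) + snd (A z))"
    and A_scale: "A (c *\<^sub>R y) = (ns_scale F c (fst (A y)), c * snd (A y))" for y z c
    using A by (simp_all add: banach_iso_times_real_def)
  have hom: "homeomorphic_map euclidean (prod_topology (ns_topology F) euclideanreal) A"
    using A by (simp add: banach_iso_times_real_def)
  have range: "range A = ns_carrier F \<times> UNIV"
    using homeomorphic_imp_surjective_map[OF hom] by simp
  have car: "fst (A y) \<in> ns_carrier F" for y
    using range by (metis mem_Sigma_iff prod.collapse rangeI)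
  have cont: "continuous_map euclidean (prod_topology (ns_topology F) euclideanreal) A"
    using hom by (rule homeomorphic_imp_continuous_map)
  have "continuous_map euclidean (ns_topology F) (fst \<circ> A)"
    and "continuous_map euclidean euclideanreal (snd \<circ> A)"
    using cont continuous_map_pairwise by blast+
  then have open_fst: "openin (ns_topology F) S \<Longrightarrow> open {y. fst (A y) \<in> S}"
    and open_snd: "open T \<Longrightarrow> open {y. snd (A y) \<in> T}" for S T
    using openin_continuous_map_preimage[of euclidean "ns_topology F" "fst \<circ> A" S]
      openin_continuous_map_preimage[of euclidean euclideanreal "snd \<circ> A" T] by simp_all
  obtain v where v: "A v = (ns_zero F, 1)"
    using range zero_closed by (metis SigmaI UNIV_I imageE)
  \<comment> \<open>A direction whose \<open>F\<close>-component has norm below \<open>r\<close>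
    raises \<open>\<Phi>\<close> at rate at most 1/2, while on \<open>N\<close> the height rises at
    a rate above 1/2. The sign of \<open>L\<close> is not known, hence the absolute value.\<close>
  define r where "r = 1 / (2 * (\<bar>L\<bar> + 1))"
  have r: "r > 0" "\<bar>L\<bar> * r \<le> 1 / 2"
    by (simp_all add: r_def field_simps)
  define N where "N = {y. fst (A y) \<in> metric.mball (ns_zero F) r} \<inter> {y. snd (A y) \<in> {1/2<..}}"
  have "open N"
    unfolding N_def by (intro open_Int open_fst open_snd) auto
  moreover have "v \<in> N"
    using v r(1) zero_closed by (simp add: N_def)
  ultimately obtain b where b: "b > 0" "ball v b \<subseteq> N"
    using open_contains_ball by blast
  define G where "G = interior W \<inter> {y. fst (A y) \<in> V}"
  have "open G" "x \<in> G"
    using xW V open_fst by (auto simp: G_def)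
  then obtain d where d: "d > 0" "ball x d \<subseteq> G"
    using open_contains_ball by blast
  have M_iff: "y \<in> M \<longleftrightarrow> \<Phi> (fst (A y)) \<le> snd (A y)" if "y \<in> G" for y
  proof -
    have "y \<in> W"
      using that interior_subset by (auto simp: G_def)
    then show ?thesis
      using MW car[of y] by (auto simp: ns_epi_def case_prod_beta)
  qed
  \<comment> \<open>\<open>b\<close> keeps the directions in \<open>N\<close>; the last term keeps
    \<open>w + t *\<^sub>R u\<close> within \<open>d\<close> of \<open>x\<close>, since
    \<open>norm u \<le> norm v + b\<close>.\<close>
  define e where "e = Min {1, b, d / (2 + norm v + b)}"
  have den: "2 + norm v + b > 0"
    using b(1) by (simp add: add_pos_nonneg)
  then have e: "e > 0" "e \<le> 1" "e \<le> b" "e \<le> d / (2 + norm v + b)"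
    using b d by (auto simp: e_def)
  then have ed: "e * (2 + norm v + b) \<le> d"
    using den by (simp add: field_simps)
  have near: "w + t *\<^sub>R u \<in> G" "w \<in> G"
    if "dist x w < e" "0 < t" "t < e" "dist u v < e" for w t u
  proof -
    have "norm u \<le> norm v + b"
      using that(4) e(3) norm_triangle_ineq[of v "u - v"] by (simp add: dist_norm)
    then have "t * norm u \<le> e * (norm v + b)"
      using that e by (intro mult_mono) auto
    moreover have "dist x (w + t *\<^sub>R u) \<le> dist x w + t * norm u"
      using that(2) dist_triangle[of x "w + t *\<^sub>R u" w] by (simp add: dist_norm)
    ultimately have "dist x (w + t *\<^sub>R u) < d"
      using that(1) ed e(1) by (simp add: algebra_simps)
    moreover have "dist x w < d"
    proof -
      have "e * 1 \<le> e * (2 + norm v + b)"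
        using e(1) b(1) by (intro mult_left_mono) auto
      then show ?thesis using that(1) ed by simp
    qed
    ultimately show "w + t *\<^sub>R u \<in> G" "w \<in> G"
      using d(2) by auto
  qed
  have "uniform_cone M v e x"
    unfolding uniform_cone_def
  proof (intro ballI allI impI)
    fix w t u assume w: "w \<in> M \<inter> ball x e" and t: "0 < t" "t < e" and u: "dist u v < e"
    let ?w = "w + t *\<^sub>R u"
    have G: "?w \<in> G" "w \<in> G"
      using near[of w t u] w t u by auto
    have uN: "u \<in> N"
      using u e(3) b(2) by (auto simp: dist_commute)
    have "ns_dist F (fst (A u)) (ns_zero F) < r"
      using uN by (simp add: N_def ns_dist_commute)
    moreover have "ns_dist F (fst (A u)) (ns_zero F) = ns_norm F (fst (A u))"
      using car[of u] zero_closed by (metis add_zero add_minus ns_dist_def scale_closed add_comm)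
    ultimately have nu: "ns_norm F (fst (A u)) < r" by simp
    have "ns_add F (fst (A ?w)) (ns_scale F (- 1) (fst (A w))) = ns_scale F t (fst (A u))"
    proof -
      let ?p = "fst (A w)" and ?q = "ns_scale F t (fst (A u))"
      have q: "?q \<in> ns_carrier F" "ns_scale F (- 1) ?p \<in> ns_carrier F"
        using car by (simp_all add: scale_closed)
      have "ns_add F (ns_add F ?p ?q) (ns_scale F (- 1) ?p)
          = ns_add F ?q (ns_add F ?p (ns_scale F (- 1) ?p))"
        using car q by (metis add_assoc add_comm)
      then show ?thesis
        using car q by (simp add: A_add A_scale add_minus add_zero)
    qed
    then have dist: "ns_dist F (fst (A ?w)) (fst (A w)) = t * ns_norm F (fst (A u))"
      using car t by (simp add: ns_dist_def norm_scale)
    have "\<Phi> (fst (A ?w)) - \<Phi> (fst (A w)) \<le> L * (t * ns_norm F (fst (A u)))"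
      using L[of "fst (A ?w)" "fst (A w)"] G dist by (auto simp: G_def)
    also have "\<dots> \<le> \<bar>L\<bar> * (t * r)"
      using nu t norm_nonneg[OF car] by (intro mult_mono) auto
    also have "\<dots> \<le> t * (1 / 2)"
      using mult_left_mono[OF r(2), of t] t by (simp add: algebra_simps)
    also have "\<dots> \<le> t * snd (A u)"
      using uN t by (intro mult_left_mono) (auto simp: N_def)
    finally have "\<Phi> (fst (A ?w)) - \<Phi> (fst (A w)) \<le> t * snd (A u)" .
    moreover have "\<Phi> (fst (A w)) \<le> snd (A w)"
      using M_iff[OF G(2)] w by simp
    ultimately show "?w \<in> M"
      using M_iff[OF G(1)] by (simp add: A_add A_scale)
  qed
  moreover have "y \<in> M" if y: "dist x y < e" and shift: "\<And>t. 0 < t \<Longrightarrow> t < e \<Longrightarrow> y + t *\<^sub>R v \<in> M" for y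
  proof -
    have A_shift: "A (y + t *\<^sub>R v) = (fst (A y), snd (A y) + t)" for t
      using car[of y] by (simp add: A_add A_scale v) (metis add_zero norm_eq_zero norm_scale
          scale_closed zero_closed mult_zero_right)
    have "\<Phi> (fst (A y)) \<le> snd (A y) + t" if "0 < t" "t < e" for t
      using M_iff[OF near(1)[of y t v]] shift[OF that] y that e(1) A_shift by simp
    note shifted = this
    have "\<Phi> (fst (A y)) \<le> snd (A y) + \<eta>" if "\<eta> > 0" for \<eta>
      using shifted[of "min (e / 2) \<eta>"] that e(1) min.cobounded2[of "e / 2" \<eta>] by force
    then have "\<Phi> (fst (A y)) \<le> snd (A y)"
      by (rule field_le_epsilon)
    then show "y \<in> M"
      using M_iff[OF near(2)[of y "e/2" v]] y e(1) by simp
  qed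
  ultimately show ?thesis
    using e(1) by blast
qed

section \<open>Decrease of the signed distance along the cone axis\<close>

text \<open>Walking from \<open>p\<close> towards \<open>q\<close> by any \<open>s < r\<close> stays
  in \<open>S\<close> and saves \<open>s\<close>. Positivity of \<open>infdist q S\<close> puts
  \<open>q\<close> outside the ball, so the walk does not overshoot.\<close>

lemma infdist_le_dist_minus:
  fixes S :: "'a::real_normed_vector set"
  assumes "r > 0" "ball p r \<subseteq> S" "infdist q S > 0"
  shows "infdist q S \<le> dist q p - r"
proof -
  define D where "D = dist q p"
  have D: "D \<ge> r"
    using assms by (metis D_def dist_commute infdist_zero less_irrefl mem_ball not_le subsetD)
  have "infdist q S \<le> D - s" if s: "0 < s" "s < r" for s
  proof (rule infdist_le2)
    let ?z = "p + (s / D) *\<^sub>R (q - p)"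
    have "D > 0" using D assms(1) by simp
    have "dist p ?z = s"
      using s \<open>D > 0\<close> by (simp add: D_def dist_norm)
    then show "?z \<in> S"
      using s assms(2) by auto
    have "q - ?z = (1 - s / D) *\<^sub>R (q - p)"
      by (simp add: algebra_simps)
    then have "dist q ?z = \<bar>1 - s / D\<bar> * D"
      by (simp add: D_def dist_norm)
    also have "\<dots> = D - s"
      using s D \<open>D > 0\<close> by (simp add: field_simps abs_if)
    finally show "dist q ?z \<le> D - s" by simp
  qed
  then have "s \<le> D - infdist q S" if "0 < s" "s < r" for s
    using that by force
  then have "r \<le> D - infdist q S"
    using assms(1) by (intro dense_le_bounded[of 0 r]) auto
  then show ?thesis
    by (simp add: D_def)
qed

text \<open>The cone property puts the ball of radius \<open>t * e\<close> around
  \<open>w + t *\<^sub>R v\<close> inside \<open>M\<close> for \<open>w\<close> in \<open>M\<close>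
  and, by contraposition, the one around \<open>c - t *\<^sub>R v\<close> inside the complement for
  \<open>c\<close> outside \<open>M\<close>. A step along \<open>v\<close> therefore reduces the
  distance to \<open>M\<close> or increases the distance to the complement, by \<open>t * e\<close>
  in all.\<close>

lemma signed_distance_decrease:
  fixes M :: "'a::real_normed_vector set"
  assumes cone: "uniform_cone M v e x" and e: "e > 0"
    and x: "x \<in> closure M" "x \<in> closure (- M)"
    and \<rho>: "\<rho> > 0" "\<rho> * (3 + 3 * norm v + e) \<le> e" "\<rho> \<le> e"
    and y: "dist x y < \<rho>" and t: "0 < t" "t < \<rho>"
  shows "infdist (y + t *\<^sub>R v) M - infdist (y + t *\<^sub>R v) (- M)
    \<le> infdist y M - infdist y (- M) - t * e"
proof -
  let ?z = "y + t *\<^sub>R v"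
  have ne: "M \<noteq> {}" "- M \<noteq> {}"
    using x by auto
  have te: "t * e > 0" "t < e"
    using t e \<rho> by auto
  \<comment> \<open>The budget for \<open>dist x c + t * norm v + t * e\<close> below:
    \<open>norm v\<close> is paid on the way to \<open>?z\<close>, in the bound for
    \<open>dist ?z c\<close> and on the step back from \<open>c\<close>.\<close>
  have \<rho>e: "\<rho> * 3 + \<rho> * (3 * norm v) + \<rho> * e \<le> e"
    using \<rho>(2) by (simp add: algebra_simps)
  have tv: "t * norm v \<le> \<rho> * norm v" "t * e \<le> \<rho> * e"
    using t e by (simp_all add: mult_right_mono)
  have pos: "0 \<le> \<rho> * norm v" "0 \<le> \<rho> * e"
    using \<rho>(1) e by simp_all
  \<comment> \<open>Distances need not be attained, so near-minimizers are used and the error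
    \<open>\<eta>\<close> is removed at the end.\<close>
  have approx: "\<exists>a\<in>S. dist q a < infdist q S + \<eta>" if "S \<noteq> {}" "\<eta> > 0" for q S \<eta>
    using that cInf_lessD[of "dist q ` S" "infdist q S + \<eta>"] by (auto simp: infdist_notempty)
  have near: "infdist q S \<le> dist x q" if "x \<in> closure S" "S \<noteq> {}" for q S
    using that infdist_triangle[of q S x] by (simp add: in_closure_iff_infdist_zero dist_commute)
  have up: "ball (w + t *\<^sub>R v) (t * e) \<subseteq> M" if "w \<in> M" "dist x w < e" for w
  proof
    fix p assume p: "p \<in> ball (w + t *\<^sub>R v) (t * e)"
    let ?v = "(p - w) /\<^sub>R t"
    have "dist ?v v < e"
      using p t by (intro dist_less_scaleRI[of t _ _ "p - (w + t *\<^sub>R v)"])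
        (auto simp: dist_norm norm_minus_commute algebra_simps)
    then have "w + t *\<^sub>R ?v \<in> M"
      using that t te by (intro uniform_coneD[OF cone]) auto
    then show "p \<in> M" using t by simp
  qed
  \<comment> \<open>A point of \<open>M\<close> in this ball would reach \<open>c\<close> by a step
    in an admissible direction, forcing \<open>c\<close> into \<open>M\<close>.\<close>
  have down: "ball (c - t *\<^sub>R v) (t * e) \<subseteq> - M"
    if "c \<notin> M" "dist x c + t * norm v + t * e < e" for c
  proof
    fix p assume p: "p \<in> ball (c - t *\<^sub>R v) (t * e)"
    show "p \<in> - M"
    proof
      assume "p \<in> M"
      have "dist x p \<le> dist x c + dist c (c - t *\<^sub>R v) + dist (c - t *\<^sub>R v) p"
        using dist_triangle[of x p c] dist_triangle[of c p "c - t *\<^sub>R v"] by simp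
      then have "dist x p < e"
        using p that(2) t by (simp add: dist_norm)
      let ?v = "(c - p) /\<^sub>R t"
      have "dist ?v v < e"
        using p t by (intro dist_less_scaleRI[of t _ _ "c - t *\<^sub>R v - p"])
          (auto simp: dist_norm algebra_simps)
      then have "p + t *\<^sub>R ?v \<in> M"
        using \<open>p \<in> M\<close> \<open>dist x p < e\<close> t te by (intro uniform_coneD[OF cone]) auto
      then show False using t that(1) by simp
    qed
  qed
  \<comment> \<open>\<open>?z\<close> is at distance \<open>dist y w\<close> from the centre of a
    ball of radius \<open>t * e\<close> in \<open>M\<close>. This covers the steps that start on the
    frontier or reach it from outside.\<close>
  have out: "t * e - dist y w \<le> infdist ?z (- M)" if "w \<in> M" "dist x w < e" for w
    unfolding infdist_notempty[OF ne(2)]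
  proof (rule cINF_greatest[OF ne(2)])
    fix c assume "c \<in> - M"
    then have "t * e \<le> dist (w + t *\<^sub>R v) c"
      using up[OF that] by (meson ComplD mem_ball not_le subsetD)
    also have "\<dots> \<le> dist (w + t *\<^sub>R v) ?z + dist ?z c"
      by (rule dist_triangle)
    finally show "t * e - dist y w \<le> dist ?z c"
      by (simp add: dist_norm norm_minus_commute)
  qed
  show ?thesis
  proof (cases "y \<in> M")
    case True
    have yx: "dist x y < e"
      using y \<rho>(3) by simp
    have zM: "?z \<in> M"
      using up[OF True yx] te(1) by auto
    \<comment> \<open>Both \<open>y\<close> and \<open>?z\<close> lie in \<open>M\<close>, so only
      the distance to the complement contributes.\<close>
    have "infdist y (- M) + t * e \<le> infdist ?z (- M)"
    proof (cases "infdist y (- M) > 0")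
      case False
      then show ?thesis
        using out[OF True yx] infdist_nonneg[of y "- M"] by simp
    next
      case pos_y: True
      have "dist x ?z \<le> dist x y + t * norm v"
        using dist_triangle[of x ?z y] t by (simp add: dist_norm)
      then have xz: "dist x ?z < \<rho> + \<rho> * norm v"
        using y tv by simp
      have "infdist y (- M) + t * e \<le> infdist ?z (- M) + \<eta>" if \<eta>: "\<eta> > 0" for \<eta>
      proof -
        have "0 < min \<eta> (\<rho> + \<rho> * norm v - dist x ?z)"
          using \<eta> xz by simp
        then obtain c where c: "c \<in> - M"
          "dist ?z c < infdist ?z (- M) + min \<eta> (\<rho> + \<rho> * norm v - dist x ?z)"
          using approx[OF ne(2)] by blast
        have "dist ?z c < \<rho> + \<rho> * norm v"
          using c(2) near[OF x(2) ne(2), of ?z] by linarith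
        moreover have "dist x c \<le> dist x y + dist y ?z + dist ?z c"
          using dist_triangle[of x c y] dist_triangle[of y c ?z] by simp
        moreover have "dist y ?z = t * norm v"
          using t by (simp add: dist_norm)
        ultimately have "dist x c + t * norm v + t * e < e"
          using y tv \<rho>e pos \<rho>(1) by linarith
        then have "infdist y (- M) \<le> dist y (c - t *\<^sub>R v) - t * e"
          using down c(1) te(1) pos_y by (intro infdist_le_dist_minus) auto
        also have "dist y (c - t *\<^sub>R v) = dist ?z c"
          by (simp add: dist_norm algebra_simps)
        finally show ?thesis
          using c(2) by linarith
      qed
      then show ?thesis
        by (rule field_le_epsilon)
    qed
    then show ?thesis
      using True zM by simp
  next
    case False
    have yM: "infdist y M < \<rho>"
      using near[OF x(1) ne(1), of y] y by simp
    have key: "infdist ?z M - infdist ?z (- M) \<le> infdist y M - t * e + \<eta>" if \<eta>: "\<eta> > 0" for \<eta>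
    proof -
      have "0 < min \<eta> (\<rho> - infdist y M)"
        using \<eta> yM by simp
      then obtain w where w: "w \<in> M" "dist y w < infdist y M + min \<eta> (\<rho> - infdist y M)"
        using approx[OF ne(1)] by blast
      have "dist x w < e"
        using dist_triangle[of x w y] w(2) y \<rho>e pos \<rho>(1) by linarith
      show ?thesis
      \<comment> \<open>If \<open>?z\<close> is still away from \<open>M\<close>, the ball around
        \<open>w + t *\<^sub>R v\<close> shortens the distance; otherwise the gain appears as depth
        inside \<open>M\<close>, by \<open>out\<close>.\<close>
      proof (cases "infdist ?z M > 0")
        case True
        have "infdist ?z M \<le> dist ?z (w + t *\<^sub>R v) - t * e"
          using up[OF w(1) \<open>dist x w < e\<close>] te(1) True by (intro infdist_le_dist_minus)
        moreover have "dist ?z (w + t *\<^sub>R v) = dist y w"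
          by (simp add: dist_norm)
        ultimately show ?thesis
          using w(2) infdist_nonneg[of ?z "- M"] by linarith
      next
        case False
        then show ?thesis
          using out[OF w(1) \<open>dist x w < e\<close>] w(2) by linarith
      qed
    qed
    have "infdist ?z M - infdist ?z (- M) \<le> infdist y M - t * e"
      using key by (rule field_le_epsilon)
    then show ?thesis
      using False by simp
  qed
qed

section \<open>Clarke's gradient and the forward implication\<close>

text \<open>The difference quotients in direction \<open>v\<close> are eventually at most
  \<open>- c\<close>, so their limit superior is negative; the zero functional would need it
  nonnegative.\<close>

lemma zero_notin_clarke_gradientI:
  assumes "\<delta> > 0" "c > 0"
    and dec: "\<And>y t. dist x y < \<delta> \<Longrightarrow> 0 < t \<Longrightarrow> t < \<delta> \<Longrightarrow> f (y + t *\<^sub>R v) \<le> f y - t * c"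
  shows "0 \<notin> clarke_gradient f x"
proof
  assume "0 \<in> clarke_gradient f x"
  then have "0 \<le> clarke_dir f x v"
    by (auto simp: clarke_gradient_def zero_ereal_def)
  moreover have "clarke_dir f x v \<le> ereal (- c)"
    unfolding clarke_dir_def
  proof (rule Limsup_bounded, unfold eventually_prod_filter, intro exI conjI allI impI)
    show "eventually (\<lambda>y. dist x y < \<delta>) (nhds x)"
      using eventually_nhds_in_open[of "ball x \<delta>" x] assms(1) by simp
    show "eventually (\<lambda>t. 0 < t \<and> t < \<delta>) (at_right 0)"
      using assms(1) eventually_at_right_field by blast
    fix y t assume "dist x y < \<delta>" "0 < t \<and> t < \<delta>"
    then show "(case (y, t) of (y, t) \<Rightarrow> ereal ((f (y + t *\<^sub>R v) - f y) / t)) \<le> ereal (- c)"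
      using dec[of y t] by (simp add: field_simps)
  qed
  ultimately show False
    using assms(2) by (metis ereal_less_eq(3) neg_0_le_iff_le not_le order_trans zero_ereal_def)
qed

lemma epi_lipschitzian_imp_sublevel:
  fixes M M_L :: "'a::banach set"
  assumes "\<forall>x\<in>M_L. epi_lipschitzian_at M x"
  shows "\<exists>U f. open U \<and> M_L \<subseteq> U \<and> locally_lipschitz_on U f \<and> M \<inter> U = {x \<in> U. f x \<le> 0} \<and>
    (\<forall>x \<in> frontier M \<inter> U. 0 \<notin> clarke_gradient f x)"
proof -
  obtain v e where e: "\<And>x. x \<in> M_L \<Longrightarrow> e x > 0"
    and cone: "\<And>x. x \<in> M_L \<Longrightarrow> uniform_cone M (v x) (e x) x"
    and cl: "\<And>x y. \<lbrakk>x \<in> M_L; dist x y < e x; \<And>t. 0 < t \<Longrightarrow> t < e x \<Longrightarrow> y + t *\<^sub>R v x \<in> M\<rbrakk> \<Longrightarrow> y \<in> M"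
    using assms epi_lipschitzian_uniform_cone[of M] by metis
  define U where "U = (\<Union>x\<in>M_L. ball x (e x))"
  \<comment> \<open>\<open>infdist\<close> to the empty set is 0, so for \<open>M = UNIV\<close>
    this is the zero function and \<open>f y \<le> 0\<close> still describes
    \<open>M\<close>.\<close>
  define f where "f y = infdist y M - infdist y (- M)" for y
  have "\<bar>f y - f z\<bar> \<le> 2 * dist y z" for y z
    using infdist_triangle_abs[of y M z] infdist_triangle_abs[of y "- M" z] by (simp add: f_def)
  then have "2-lipschitz_on S f" for S
    by (intro lipschitz_onI) (auto simp: dist_real_def)
  then have "locally_lipschitz_on U f"
    unfolding locally_lipschitz_on_def by (intro ballI exI[of _ UNIV] exI[of _ 2]) auto
  moreover have "y \<in> M \<longleftrightarrow> f y \<le> 0" if y: "y \<in> U" for y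
  proof (cases "y \<in> M")
    case True
    then show ?thesis by (simp add: f_def infdist_nonneg)
  next
    case False
    obtain x where x: "x \<in> M_L" "dist x y < e x"
      using y by (auto simp: U_def)
    \<comment> \<open>A point of the closure is moved into \<open>M\<close> by every small step
      along \<open>v x\<close>, and then \<open>cl\<close> puts the point itself into
      \<open>M\<close>.\<close>
    have "y \<notin> closure M"
      using False cl[OF x] uniform_cone_closure[OF cone[OF x(1)] x(2)] by blast
    moreover have "M \<noteq> {}"
      using assms x(1) by (auto simp: epi_lipschitzian_at_def)
    ultimately have "infdist y M > 0"
      by (metis in_closure_iff_infdist_zero infdist_nonneg less_eq_real_def)
    then show ?thesis
      using False by (simp add: f_def)
  qed
  then have "M \<inter> U = {x \<in> U. f x \<le> 0}" by blast
  moreover have "0 \<notin> clarke_gradient f y" if y: "y \<in> frontier M \<inter> U" for y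
  proof -
    obtain x where x: "x \<in> M_L" "dist x y < e x"
      using y by (auto simp: U_def)
    define r where "r = e x - dist x y"
    have r: "r > 0" "uniform_cone M (v x) r y"
      using x uniform_cone_shift[OF cone] by (simp_all add: r_def)
    \<comment> \<open>The factor in the smallness condition of
      \<open>signed_distance_decrease\<close>; as it is at least 1, \<open>r / ?k\<close> satisfies
      both bounds there.\<close>
    let ?k = "3 + 3 * norm (v x) + r"
    have k: "?k \<ge> 1"
      using r(1) by (simp add: add_increasing2 add.assoc)
    have \<rho>: "r / ?k > 0" "r / ?k * ?k \<le> r" "r / ?k \<le> r"
      using k r(1) order_less_le_trans[OF zero_less_one k] by (simp_all add: divide_le_eq)
    have "y \<in> closure M" "y \<in> closure (- M)"
      using y by (auto simp: frontier_closures)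
    then show ?thesis
      using signed_distance_decrease[OF r(2,1) _ _ \<rho>] r(1) \<rho>(1) unfolding f_def
      by (intro zero_notin_clarke_gradientI[of "r / ?k" r y _ "v x"]) auto
  qed
  moreover have "open U" "M_L \<subseteq> U"
    using e by (auto simp: U_def)
  ultimately show ?thesis by blast
qed


section \<open>Epigraph charts from decreasing functions\<close>

text \<open>The model spaces of the converse are kernels inside the ambient space, with its
  operations and norm.\<close>

definition ns_subspace :: "'a::real_normed_vector set \<Rightarrow> 'a nspace" where
  "ns_subspace S = \<lparr>ns_carrier = S, ns_zero = 0, ns_add = (+), ns_scale = (*\<^sub>R), ns_norm = norm\<rparr>"

lemma ns_subspace_simps [simp]:
  "ns_carrier (ns_subspace S) = S" "ns_zero (ns_subspace S) = 0" "ns_add (ns_subspace S) = (+)"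
  "ns_scale (ns_subspace S) = (*\<^sub>R)" "ns_norm (ns_subspace S) = norm"
  by (simp_all add: ns_subspace_def)

lemma ns_dist_subspace: "u \<in> S \<Longrightarrow> v \<in> S \<Longrightarrow> ns_dist (ns_subspace S) u v = dist u v"
  by (simp add: ns_dist_def dist_norm)

lemma normed_ns_subspace:
  assumes "subspace S"
  shows "normed_nspace (ns_subspace S)"
proof
  show "\<exists>v\<in>ns_carrier (ns_subspace S). ns_add (ns_subspace S) u v = ns_zero (ns_subspace S)"
    if "u \<in> ns_carrier (ns_subspace S)" for u
    using that subspace_neg[OF assms, of u] by (auto intro!: bexI[of _ "- u"])
qed (use assms in \<open>auto simp: algebra_simps norm_triangle_ineq subspace_0 subspace_add subspace_scale\<close>)

lemma ns_topology_subspace: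
  assumes "subspace S"
  shows "ns_topology (ns_subspace S) = top_of_set S"
proof -
  interpret normed_nspace "ns_subspace S"
    by (rule normed_ns_subspace[OF assms])
  have "metric.mball x r = S \<inter> ball x r" if "x \<in> S" for x r
    using that unfolding metric.mball_def by (auto simp: ns_dist_subspace)
  then have "openin (ns_topology (ns_subspace S)) T \<longleftrightarrow> openin (top_of_set S) T" for T
    unfolding metric.openin_mtopology openin_euclidean_subtopology_iff
    by (fastforce simp: subset_iff dist_commute)
  then show ?thesis
    by (simp add: topology_eq)
qed

lemma banach_ns_subspace:
  fixes S :: "'a::banach set"
  assumes "subspace S" "closed S"
  shows "banach_nspace (ns_subspace S)"
proof -
  interpret normed_nspace "ns_subspace S"
    by (rule normed_ns_subspace[OF assms(1)])
  show ?thesis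
  proof
    show "metric.mcomplete"
      unfolding metric.mcomplete_def
    proof (intro allI impI)
      fix \<sigma> assume \<sigma>: "metric.MCauchy \<sigma>"
      then have S: "\<sigma> n \<in> S" for n
        unfolding metric.MCauchy_def by auto
      have "Cauchy \<sigma>"
        using \<sigma> S unfolding metric.MCauchy_def Cauchy_def by (simp add: ns_dist_subspace)
      moreover have "complete S"
        using assms(2) complete_eq_closed by blast
      ultimately obtain l where "l \<in> S" "\<sigma> \<longlonglongrightarrow> l"
        using S unfolding complete_def by blast
      then have "limitin (top_of_set S) \<sigma> l sequentially"
        using S by (simp add: limitin_subtopology)
      then show "\<exists>l. limitin (ns_topology (ns_subspace S)) \<sigma> l sequentially"
        unfolding ns_topology_subspace[OF assms(1)] by blast
    qed
  qed
qed

section \<open>Charts from the splitting along a vector\<close>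

text \<open>\<open>y - \<phi> y *\<^sub>R v\<close> is the projection onto the kernel along
  \<open>v\<close>, and the inverse is \<open>u + t *\<^sub>R v\<close>; both maps are continuous
  because \<open>\<phi>\<close> is.\<close>

lemma banach_iso_kernel:
  fixes \<phi> :: "'a::real_normed_vector \<Rightarrow> real"
  assumes "bounded_linear \<phi>" "\<phi> v = 1"
  shows "banach_iso_times_real (ns_subspace {y. \<phi> y = 0}) (\<lambda>y. (y - \<phi> y *\<^sub>R v, \<phi> y))"
proof -
  interpret bounded_linear \<phi> by (rule assms(1))
  let ?S = "{y. \<phi> y = 0}"
  have sub: "subspace ?S"
    by (simp add: subspace_def zero add scaleR)
  have "homeomorphism UNIV (?S \<times> UNIV) (\<lambda>y. (y - \<phi> y *\<^sub>R v, \<phi> y)) (\<lambda>(u, t). u + t *\<^sub>R v)"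
    unfolding homeomorphism_def
  proof (intro conjI ballI)
    show "continuous_on UNIV (\<lambda>y. (y - \<phi> y *\<^sub>R v, \<phi> y))"
      by (intro continuous_intros continuous_on)
    show "continuous_on (?S \<times> UNIV) (\<lambda>(u, t). u + t *\<^sub>R v)"
      unfolding case_prod_beta by (intro continuous_intros)
    show "(\<lambda>y. (y - \<phi> y *\<^sub>R v, \<phi> y)) ` UNIV = ?S \<times> UNIV"
    proof -
      have "(u, t) \<in> range (\<lambda>y. (y - \<phi> y *\<^sub>R v, \<phi> y))" if "\<phi> u = 0" for u t
        using assms(2) that by (intro image_eqI[of _ _ "u + t *\<^sub>R v"]) (auto simp: add scaleR)
      then show ?thesis
        using assms(2) by (auto simp: diff scaleR)
    qed
    show "(\<lambda>(u, t). u + t *\<^sub>R v) ` (?S \<times> UNIV) = UNIV"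
    proof -
      have "y \<in> (\<lambda>(u, t). u + t *\<^sub>R v) ` (?S \<times> UNIV)" for y
        using assms(2) by (intro image_eqI[of _ _ "(y - \<phi> y *\<^sub>R v, \<phi> y)"]) (auto simp: diff scaleR)
      then show ?thesis by blast
    qed
  qed (use assms(2) in \<open>auto simp: diff scaleR add\<close>)
  then have "homeomorphic_map euclidean (top_of_set (?S \<times> UNIV)) (\<lambda>y. (y - \<phi> y *\<^sub>R v, \<phi> y))"
    by (auto simp: homeomorphic_map_maps homeomorphic_maps_def homeomorphism_def
        continuous_map_in_subtopology intro!: exI[of _ "\<lambda>(u, t). u + t *\<^sub>R v"])
  moreover have "top_of_set (?S \<times> UNIV) = prod_topology (top_of_set ?S) euclideanreal"
    using prod_topology_subtopology_eu[of ?S "UNIV :: real set"] by simp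
  ultimately show ?thesis
    unfolding banach_iso_times_real_def ns_topology_subspace[OF sub]
    by (simp add: add scaleR algebra_simps)
qed

text \<open>Hides the carrier encoding: a chart is reduced to a Lipschitz estimate on the kernel and
  a description of \<open>M\<close> by heights along \<open>v\<close>.\<close>

lemma epi_lipschitzian_atI_kernel:
  fixes \<phi> :: "'a::banach \<Rightarrow> real"
  assumes "bounded_linear \<phi>" "\<phi> v = 1" "x \<in> M" "x \<in> interior W" "r > 0"
    and lip: "\<And>u u'. \<lbrakk>\<phi> u = 0; \<phi> u' = 0; dist (x - \<phi> x *\<^sub>R v) u < r; dist (x - \<phi> x *\<^sub>R v) u' < r\<rbrakk>
      \<Longrightarrow> \<bar>\<Phi> u - \<Phi> u'\<bar> \<le> L * dist u u'"
    and M: "\<And>y. y \<in> W \<Longrightarrow> y \<in> M \<longleftrightarrow> \<Phi> (y - \<phi> y *\<^sub>R v) \<le> \<phi> y"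
  shows "epi_lipschitzian_at M x"
proof -
  interpret bounded_linear \<phi> by (rule assms(1))
  let ?S = "{y. \<phi> y = 0}" and ?x = "x - \<phi> x *\<^sub>R v"
  let ?A = "\<lambda>y. (y - \<phi> y *\<^sub>R v, \<phi> y)"
  have sub: "subspace ?S"
    by (simp add: subspace_def zero add scaleR)
  have "closed ?S"
    by (intro closed_Collect_eq continuous_on continuous_intros)
  then have "banach_nspace (ns_subspace ?S)"
    by (rule banach_ns_subspace[OF sub])
  moreover have car: "\<phi> (y - \<phi> y *\<^sub>R v) = 0" for y
    using assms(2) by (simp add: diff scaleR)
  have "ns_lipschitz_near (ns_subspace ?S) ?x \<Phi>"
    unfolding ns_lipschitz_near_def ns_topology_subspace[OF sub]
  proof (intro exI conjI ballI)
    show "openin (top_of_set ?S) (?S \<inter> ball ?x r)"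
      by (simp add: openin_open_Int)
    show "?x \<in> ?S \<inter> ball ?x r"
      using car assms(5) by simp
    show "\<bar>\<Phi> u - \<Phi> u'\<bar> \<le> L * ns_dist (ns_subspace ?S) u u'"
      if "u \<in> ?S \<inter> ball ?x r" "u' \<in> ?S \<inter> ball ?x r" for u u'
      using lip that by (simp add: ns_dist_subspace)
  qed
  moreover have "M \<inter> W = W \<inter> ?A -` ns_epi (ns_subspace ?S) \<Phi>"
    using M car by (auto simp: ns_epi_def)
  ultimately have "epi_lipschitzian_in (ns_subspace ?S) M x"
    unfolding epi_lipschitzian_in_def using banach_iso_kernel[OF assms(1,2)] assms(4)
    by (intro conjI exI[of _ W] exI[of _ ?A] exI[of _ \<Phi>]) simp_all
  then show ?thesis
    using assms(3) epi_lipschitzian_atI by blast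
qed

section \<open>A Lipschitz implicit function along a direction of decrease\<close>

lemma zero_notin_clarke_gradientD:
  assumes "0 \<notin> clarke_gradient f x"
  shows "\<exists>v \<delta> c. \<delta> > 0 \<and> c > 0 \<and>
    (\<forall>y t. dist x y < \<delta> \<longrightarrow> 0 < t \<longrightarrow> t < \<delta> \<longrightarrow> f (y + t *\<^sub>R v) \<le> f y - t * c)"
proof -
  obtain v where "clarke_dir f x v < 0"
    using assms by (auto simp: clarke_gradient_def zero_ereal_def not_le)
  \<comment> \<open>A number strictly between the limit superior and 0 bounds all nearby quotients,
    which makes the rate \<open>- b\<close> uniform.\<close>
  then obtain b where b: "clarke_dir f x v < ereal b" "ereal b < 0"
    using ereal_dense2 by blast
  obtain P Q where P: "eventually P (nhds x)" and Q: "eventually Q (at_right (0::real))"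
    and PQ: "\<And>y t. P y \<Longrightarrow> Q t \<Longrightarrow> (f (y + t *\<^sub>R v) - f y) / t < b"
    using Limsup_lessD[OF b(1)[unfolded clarke_dir_def]] unfolding eventually_prod_filter by auto
  obtain d where d: "d > 0" "\<And>y. dist y x < d \<Longrightarrow> P y"
    using P unfolding eventually_nhds_metric by blast
  obtain s where s: "s > 0" "\<And>t. 0 < t \<Longrightarrow> t < s \<Longrightarrow> Q t"
    using Q unfolding eventually_at_right_field by auto
  have "f (y + t *\<^sub>R v) \<le> f y - t * (- b)" if "dist x y < min d s" "0 < t" "t < min d s" for y t
    using PQ[of y t] d(2)[of y] s(2)[of t] that by (simp add: dist_commute field_simps)
  moreover have "- b > 0" "min d s > 0"
    using b(2) d(1) s(1) by (simp_all add: zero_ereal_def)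
  ultimately show ?thesis by blast
qed

text \<open>On each line parallel to \<open>v\<close> near \<open>x\<close>, \<open>f\<close>
  decreases at rate at least \<open>c\<close>, while moving the line changes \<open>f\<close> at
  rate at most \<open>L\<close>. So each line has exactly one zero in the height range considered;
  it moves at rate at most \<open>L / c\<close>, and \<open>f \<le> 0\<close> holds there from the
  zero upwards.\<close>

lemma implicit_epigraph:
  fixes \<phi> :: "'a::real_normed_vector \<Rightarrow> real"
  assumes \<phi>: "bounded_linear \<phi>" "\<phi> v = 1" and pos: "d > 0" "c > 0" and fx: "f x = 0"
    and lip: "L-lipschitz_on (ball x d) f"
    and dec: "\<And>y t. dist x y < d \<Longrightarrow> 0 < t \<Longrightarrow> t < d \<Longrightarrow> f (y + t *\<^sub>R v) \<le> f y - t * c"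
  shows "\<exists>W r \<Phi> K. open W \<and> x \<in> W \<and> W \<subseteq> ball x d \<and> r > 0 \<and>
    (\<forall>u u'. \<phi> u = 0 \<longrightarrow> \<phi> u' = 0 \<longrightarrow> dist (x - \<phi> x *\<^sub>R v) u < r \<longrightarrow> dist (x - \<phi> x *\<^sub>R v) u' < r
      \<longrightarrow> \<bar>\<Phi> u - \<Phi> u'\<bar> \<le> K * dist u u') \<and>
    (\<forall>y\<in>W. f y \<le> 0 \<longleftrightarrow> \<Phi> (y - \<phi> y *\<^sub>R v) \<le> \<phi> y)"
proof -
  interpret bounded_linear \<phi> by (rule \<phi>(1))
  have L: "L \<ge> 0"
    using lip by (rule lipschitz_on_nonneg)
  define p where "p = x - \<phi> x *\<^sub>R v"
  define s where "s = \<phi> x"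
  \<comment> \<open>\<open>a\<close> is the half-height and \<open>r\<close> the base radius of a
    cylinder inside the ball; \<open>2 * a < d\<close> lets \<open>dec\<close> compare any two of
    its heights. The bound on \<open>r\<close> gives \<open>L * r < a * c\<close>, so a change of
    base cannot undo the change of \<open>f\<close> over height \<open>a\<close>.\<close>
  define a where "a = d / (3 * (1 + norm v))"
  define r where "r = min (d / 3) (a * c / (L + 1))"
  have nv: "1 + norm v > 0" by (simp add: add_pos_nonneg)
  have a: "a > 0" "3 * a + 3 * (a * norm v) = d"
  proof -
    show "a > 0"
      using pos(1) nv by (simp add: a_def)
    have "a * (3 * (1 + norm v)) = d"
      using nv by (simp add: a_def)
    then show "3 * a + 3 * (a * norm v) = d"
      by (simp add: algebra_simps)
  qed
  have av: "0 \<le> a * norm v"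
    using a by simp
  have "L + 1 > 0" using L by simp
  then have r: "r > 0" "r \<le> d / 3" "r * (L + 1) \<le> a * c"
  proof -
    show "r > 0"
      using pos a(1) \<open>L + 1 > 0\<close> by (simp add: r_def)
    show "r \<le> d / 3"
      unfolding r_def by (rule min.cobounded1)
    have "r \<le> a * c / (L + 1)"
      by (simp add: r_def)
    then show "r * (L + 1) \<le> a * c"
      using \<open>L + 1 > 0\<close> by (simp add: pos_le_divide_eq)
  qed
  have Lr: "L * r < a * c"
    using r by (simp add: algebra_simps)
  have x: "x = p + s *\<^sub>R v"
    by (simp add: p_def s_def)
  have inball: "dist x (u + t *\<^sub>R v) < d" if "dist p u < r" "\<bar>t - s\<bar> \<le> a" for u t
  proof -
    have "dist x (u + t *\<^sub>R v) = norm ((p - u) + (s - t) *\<^sub>R v)"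
      by (simp add: x dist_norm algebra_simps)
    also have "\<dots> \<le> dist p u + \<bar>s - t\<bar> * norm v"
      by (metis dist_norm norm_scaleR norm_triangle_ineq)
    also have "\<bar>s - t\<bar> * norm v \<le> a * norm v"
      using that(2) by (intro mult_right_mono) auto
    finally show ?thesis
      using that(1) r(2) a av pos(1) by linarith
  qed
  have lipu: "\<bar>f (u + t *\<^sub>R v) - f (u' + t *\<^sub>R v)\<bar> \<le> L * dist u u'"
    if "dist p u < r" "dist p u' < r" "\<bar>t - s\<bar> \<le> a" for u u' t
    using lipschitz_onD[OF lip, of "u + t *\<^sub>R v" "u' + t *\<^sub>R v"] inball[OF that(1,3)]
      inball[OF that(2,3)] by (simp add: dist_real_def)
  have mono: "f (u + t' *\<^sub>R v) \<le> f (u + t *\<^sub>R v) - (t' - t) * c"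
    if "dist p u < r" "\<bar>t - s\<bar> \<le> a" "\<bar>t' - s\<bar> \<le> a" "t \<le> t'" for u t t'
  proof (cases "t = t'")
    case False
    have "t' - t < d"
      using that a av pos(1) by linarith
    then show ?thesis
      using dec[OF inball[OF that(1,2)], of "t' - t"] that(4) False by (simp add: algebra_simps)
  qed simp
  \<comment> \<open>On the line through \<open>x\<close> the values at \<open>s + a\<close> and
    \<open>s - a\<close> are at most \<open>- a * c\<close> and at least \<open>a * c\<close>.
    Moving the base to \<open>u\<close> changes them by less than \<open>a * c\<close>, so the signs
    persist and the intermediate value theorem applies.\<close>
  have root: "\<exists>t. \<bar>t - s\<bar> \<le> a \<and> f (u + t *\<^sub>R v) = 0" if u: "dist p u < r" for u
  proof -
    have p: "dist p p < r" using r by simp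
    have ends: "\<bar>(s - a) - s\<bar> \<le> a" "\<bar>(s + a) - s\<bar> \<le> a" "\<bar>s - s\<bar> \<le> a"
      using a(1) by simp_all
    have Lu: "L * dist u p < a * c"
      using mult_left_mono[OF less_imp_le[OF u] L] Lr by (simp add: dist_commute)
    have "f (u + (s + a) *\<^sub>R v) \<le> 0"
      using mono[OF p ends(3,2)] lipu[OF u p ends(2)] Lu fx a(1) by (simp add: x)
    moreover have "0 \<le> f (u + (s - a) *\<^sub>R v)"
      using mono[OF p ends(1,3)] lipu[OF u p ends(1)] Lu fx a(1) by (simp add: x)
    moreover have "continuous_on {s - a..s + a} (\<lambda>t. f (u + t *\<^sub>R v))"
    proof (rule continuous_on_compose2[OF lipschitz_on_continuous_on[OF lip]])
      show "continuous_on {s - a..s + a} (\<lambda>t. u + t *\<^sub>R v)"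
        by (intro continuous_intros)
      show "(\<lambda>t. u + t *\<^sub>R v) ` {s - a..s + a} \<subseteq> ball x d"
        using inball[OF u] by (auto simp: abs_le_iff)
    qed
    ultimately obtain t where "s - a \<le> t" "t \<le> s + a" "f (u + t *\<^sub>R v) = 0"
      using IVT2'[of "\<lambda>t. f (u + t *\<^sub>R v)" "s + a" 0 "s - a"] a(1) by auto
    then show ?thesis
      by (intro exI[of _ t]) (simp add: abs_le_iff)
  qed
  define \<Phi> where "\<Phi> u = (SOME t. \<bar>t - s\<bar> \<le> a \<and> f (u + t *\<^sub>R v) = 0)" for u
  have \<Phi>: "\<bar>\<Phi> u - s\<bar> \<le> a" "f (u + \<Phi> u *\<^sub>R v) = 0" if "dist p u < r" for u
    using someI_ex[OF root[OF that]] unfolding \<Phi>_def by auto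
  \<comment> \<open>On the line through \<open>u'\<close>, \<open>f\<close> drops by at least
    \<open>c\<close> times the height difference between \<open>\<Phi> u\<close> and
    \<open>\<Phi> u'\<close>, from a value at most \<open>L * dist u u'\<close> down to 0.\<close>
  have half: "\<Phi> u' - \<Phi> u \<le> L / c * dist u u'" if u: "dist p u < r" "dist p u' < r" for u u'
  proof (cases "\<Phi> u \<le> \<Phi> u'")
    case True
    have "(\<Phi> u' - \<Phi> u) * c \<le> L * dist u u'"
      using mono[OF u(2) \<Phi>(1)[OF u(1)] \<Phi>(1)[OF u(2)] True] \<Phi>(2)[OF u(2)] \<Phi>(2)[OF u(1)]
        lipu[OF u \<Phi>(1)[OF u(1)]] by simp
    then show ?thesis
      using pos(2) by (simp add: field_simps)
  next
    case False
    then show ?thesis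
      using L pos(2) by (smt (verit) divide_nonneg_pos mult_nonneg_nonneg zero_le_dist)
  qed
  define W where "W = {y. dist p (y - \<phi> y *\<^sub>R v) < r} \<inter> {y. \<bar>\<phi> y - s\<bar> < a}"
  have "open W"
    unfolding W_def by (intro open_Int open_Collect_less continuous_intros continuous_on)
  moreover have "x \<in> W"
    using r(1) a(1) by (simp add: W_def p_def s_def)
  moreover have "W \<subseteq> ball x d"
  proof
    fix y assume "y \<in> W"
    then show "y \<in> ball x d"
      using inball[of "y - \<phi> y *\<^sub>R v" "\<phi> y"] by (simp add: W_def)
  qed
  moreover have "\<forall>u u'. \<phi> u = 0 \<longrightarrow> \<phi> u' = 0 \<longrightarrow> dist p u < r \<longrightarrow> dist p u' < r
      \<longrightarrow> \<bar>\<Phi> u - \<Phi> u'\<bar> \<le> L / c * dist u u'"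
    using half by (simp add: abs_le_iff) (metis dist_commute)
  moreover have "f y \<le> 0 \<longleftrightarrow> \<Phi> (y - \<phi> y *\<^sub>R v) \<le> \<phi> y" if "y \<in> W" for y
  proof -
    let ?u = "y - \<phi> y *\<^sub>R v"
    have u: "dist p ?u < r" and y: "\<bar>\<phi> y - s\<bar> \<le> a"
      using that by (simp_all add: W_def)
    show ?thesis
    proof (cases "\<Phi> ?u \<le> \<phi> y")
      case True
      then have "0 \<le> (\<phi> y - \<Phi> ?u) * c"
        using pos(2) by simp
      then show ?thesis
        using mono[OF u \<Phi>(1)[OF u] y True] \<Phi>(2)[OF u] True by simp
    next
      case False
      then have "0 < (\<Phi> ?u - \<phi> y) * c"
        using pos(2) by simp
      then show ?thesis
        using mono[OF u y \<Phi>(1)[OF u]] \<Phi>(2)[OF u] False by simp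
    qed
  qed
  ultimately show ?thesis
    using r(1) unfolding p_def by blast
qed

section \<open>The converse implication\<close>

text \<open>A constant graph below \<open>x\<close> serves, with \<open>W\<close> cut down to the
  part of the interior above it. A nonzero \<open>v\<close> provides the vertical direction; the
  zero space has no factor \<open>\<real>\<close>.\<close>

lemma epi_lipschitzian_at_interior:
  fixes M :: "'a::banach set"
  assumes "(UNIV :: 'a set) \<noteq> {0}" "x \<in> interior M"
  shows "epi_lipschitzian_at M x"
proof -
  obtain v :: 'a where "v \<noteq> 0"
    using assms(1) by auto
  then obtain \<phi> :: "'a \<Rightarrow> real" where \<phi>: "bounded_linear \<phi>" "\<phi> v = 1"
    using exists_bounded_linear_eq_one by blast
  let ?W = "interior M \<inter> {y. \<phi> x - 1 < \<phi> y}"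
  have "open ?W"
    using \<phi>(1) by (intro open_Int open_Collect_less continuous_intros linear_continuous_on) auto
  then have "x \<in> interior ?W"
    using assms(2) by (subst interior_open) auto
  then show ?thesis
    using assms(2) interior_subset
    by (intro epi_lipschitzian_atI_kernel[OF \<phi>, of x M ?W 1 "\<lambda>_. \<phi> x - 1" 0]) auto
qed

text \<open>At a point of \<open>M\<close> outside its interior \<open>f\<close> vanishes, since
  \<open>f x < 0\<close> would persist nearby. Decrease at a positive rate forces
  \<open>v \<noteq> 0\<close>, so some \<open>\<phi>\<close> with \<open>\<phi> v = 1\<close> exists
  and the implicit function provides the chart.\<close>

lemma sublevel_imp_epi_lipschitzian:
  fixes M :: "'a::banach set"
  assumes nz: "(UNIV :: 'a set) \<noteq> {0}" and U: "open U" and f: "locally_lipschitz_on U f"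
    and M: "M \<inter> U = {x \<in> U. f x \<le> 0}"
    and grad: "\<And>x. x \<in> frontier M \<inter> U \<Longrightarrow> 0 \<notin> clarke_gradient f x"
    and x: "x \<in> M" "x \<in> U"
  shows "epi_lipschitzian_at M x"
proof (cases "x \<in> interior M")
  case True
  then show ?thesis
    by (rule epi_lipschitzian_at_interior[OF nz])
next
  case False
  then have "x \<in> frontier M \<inter> U"
    using x closure_subset by (auto simp: frontier_def)
  then have "0 \<notin> clarke_gradient f x"
    by (rule grad)
  then obtain v \<delta> c where \<delta>: "\<delta> > 0" "c > 0"
    and dec: "\<And>y t. dist x y < \<delta> \<Longrightarrow> 0 < t \<Longrightarrow> t < \<delta> \<Longrightarrow> f (y + t *\<^sub>R v) \<le> f y - t * c"
    using zero_notin_clarke_gradientD by metis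
  have "v \<noteq> 0"
  proof
    assume "v = 0"
    then have "\<delta> / 2 * c \<le> 0"
      using dec[of x "\<delta> / 2"] \<delta> by simp
    then show False
      using \<delta> by (simp add: mult_le_0_iff)
  qed
  then obtain \<phi> :: "'a \<Rightarrow> real" where \<phi>: "bounded_linear \<phi>" "\<phi> v = 1"
    using exists_bounded_linear_eq_one by blast
  obtain V L where V: "open V" "x \<in> V" "L-lipschitz_on (V \<inter> U) f"
    using f x(2) unfolding locally_lipschitz_on_def by blast
  have "open (V \<inter> U)"
    using U V by blast
  then obtain b where b: "b > 0" "ball x b \<subseteq> V \<inter> U"
    using V(2) x(2) open_contains_ball by (metis IntI)
  define d where "d = min \<delta> b"
  have d: "d > 0" "d \<le> \<delta>" "ball x d \<subseteq> V \<inter> U"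
    using b \<delta> by (auto simp: d_def)
  have lip: "L-lipschitz_on (ball x d) f"
    using V(3) d(3) by (rule lipschitz_on_subset)
  have fx: "f x = 0"
  proof (rule antisym)
    show "f x \<le> 0"
      using x M by blast
    show "0 \<le> f x"
    proof (rule ccontr)
      assume "\<not> 0 \<le> f x"
      let ?N = "{y \<in> ball x d. f y \<in> {..<0}}"
      have "open ?N"
        using continuous_open_preimage[OF lipschitz_on_continuous_on[OF lip] open_ball open_lessThan]
        by (simp add: vimage_def Int_def)
      moreover have "?N \<subseteq> M"
        using M d(3) by fastforce
      moreover have "x \<in> ?N"
        using \<open>\<not> 0 \<le> f x\<close> d(1) by simp
      ultimately show False
        using False interiorI by blast
    qed
  qed
  have "f (y + t *\<^sub>R v) \<le> f y - t * c" if "dist x y < d" "0 < t" "t < d" for y t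
    using dec[of y t] that d(2) by simp
  from implicit_epigraph[OF \<phi> d(1) \<delta>(2) fx lip this]
  obtain W r \<Phi> K where W: "open W" "x \<in> W" "W \<subseteq> ball x d" and r: "r > 0"
    and lip\<Phi>: "\<And>u u'. \<lbrakk>\<phi> u = 0; \<phi> u' = 0; dist (x - \<phi> x *\<^sub>R v) u < r; dist (x - \<phi> x *\<^sub>R v) u' < r\<rbrakk>
      \<Longrightarrow> \<bar>\<Phi> u - \<Phi> u'\<bar> \<le> K * dist u u'"
    and epi: "\<And>y. y \<in> W \<Longrightarrow> f y \<le> 0 \<longleftrightarrow> \<Phi> (y - \<phi> y *\<^sub>R v) \<le> \<phi> y"
    by blast
  have "y \<in> M \<longleftrightarrow> \<Phi> (y - \<phi> y *\<^sub>R v) \<le> \<phi> y" if "y \<in> W" for y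
  proof -
    have "y \<in> U"
      using that W(3) d(3) by blast
    then have "y \<in> M \<longleftrightarrow> f y \<le> 0"
      using M by blast
    then show ?thesis
      using epi[OF that] by simp
  qed
  then show ?thesis
    using W(1,2) x(1) r lip\<Phi>
    by (intro epi_lipschitzian_atI_kernel[OF \<phi>, of x M W r \<Phi> K]) (auto simp: interior_open)
qed

theorem theorem3:
  fixes M M_L :: "'a::banach set"
  assumes "(UNIV :: 'a set) \<noteq> {0}"
    and "M_L \<subseteq> M"
  shows "(\<forall>x\<in>M_L. epi_lipschitzian_at M x) \<longleftrightarrow>
    (\<exists>U f. open U \<and> M_L \<subseteq> U \<and> locally_lipschitz_on U f \<and>
       M \<inter> U = {x \<in> U. f x \<le> 0} \<and>
       (\<forall>x \<in> frontier M \<inter> U. 0 \<notin> clarke_gradient f x))"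
proof
  assume "\<forall>x\<in>M_L. epi_lipschitzian_at M x"
  then show "\<exists>U f. open U \<and> M_L \<subseteq> U \<and> locally_lipschitz_on U f \<and> M \<inter> U = {x \<in> U. f x \<le> 0} \<and>
      (\<forall>x \<in> frontier M \<inter> U. 0 \<notin> clarke_gradient f x)"
    by (rule epi_lipschitzian_imp_sublevel)
next
  assume "\<exists>U f. open U \<and> M_L \<subseteq> U \<and> locally_lipschitz_on U f \<and> M \<inter> U = {x \<in> U. f x \<le> 0} \<and>
      (\<forall>x \<in> frontier M \<inter> U. 0 \<notin> clarke_gradient f x)"
  then obtain U f where "open U" "M_L \<subseteq> U" "locally_lipschitz_on U f" "M \<inter> U = {x \<in> U. f x \<le> 0}"
    "\<And>x. x \<in> frontier M \<inter> U \<Longrightarrow> 0 \<notin> clarke_gradient f x"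
    by blast
  then show "\<forall>x\<in>M_L. epi_lipschitzian_at M x"
    using sublevel_imp_epi_lipschitzian[OF assms(1)] assms(2) by blast
qed

end
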